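(* The $K$-linear map $Z_*:\mathfrak C\otimes_{\mathbb F_q}K\to\mathcal Z$ sending each word $\mathfrak a$ to $\operatorname{Li}(\mathfrak a)$ is well defined (i.e. $\operatorname{Li}(\mathfrak a)\in\mathcal Z$ for every word $\mathfrak a$) and is a homomorphism of $K$-algebras, where $\mathfrak C\otimes_{\mathbb F_q}K$ carries the $K$-bilinear extension of the stuffle product $*$.
   Context: Let $q$ be a prime power, $\mathbb F_q$ the field with $q$ elements, $A=\mathbb F_q[\theta]$, $A_+$ its set of monic polynomials, $K=\mathbb F_q(\theta)$, and $K_\infty$ the completion of $K$ at $\infty$ (valuation with $v_\infty(\theta)=-1$); $\mathbb N=\{1,2,\dots\}$. For $\mathfrak s=(s_1,\dots,s_r)\in\mathbb N^r$, Thakur's multiple zeta value is $\zeta_A(\mathfrak s)=\sum a_1^{-s_1}\cdots a_r^{-s_r}\in K_\infty$, the sum over $(a_1,\dots,a_r)\in A_+^r$ with $\deg a_1>\cdots>\deg a_r$; the empty tuple gives $1$. $\mathcal Z$ denotes the $K$-vector subspace of $K_\infty$ spanned by all these values (a $K$-algebra under multiplication in $K_\infty$). Put $\ell_0=1$, $\ell_d=\prod_{i=1}^d(\theta-\theta^{q^i})$ for $d\ge1$, and $\operatorname{Li}(\mathfrak s)=\sum_{d_1>\cdots>d_n\ge0}\ell_{d_1}^{-s_1}\cdots\ell_{d_n}^{-s_n}$ for $\mathfrak s=(s_1,\dots,s_n)\in\mathbb N^n$. $\Sigma=\{x_n\}_{n\in\mathbb N}$ is an alphabet; words are finite strings of letters,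 $1$ is the empty word; $\mathfrak C$ is the $\mathbb F_q$-vector space with basis the set of words, concatenation written as juxtaposition; a nonempty word is $\mathfrak a=x_a\mathfrak a_-$ with $x_a$ its first letter. For a word, $\operatorname{Li}(1)=1$ and $\operatorname{Li}(x_{s_1}\cdots x_{s_n})=\operatorname{Li}(s_1,\dots,s_n)$. The stuffle product $*$ on $\mathfrak C$ is bilinear with $1*\mathfrak a=\mathfrak a*1=\mathfrak a$ and, for nonempty words $\mathfrak a=x_a\mathfrak a_-$, $\mathfrak b=x_b\mathfrak b_-$, $\mathfrak a*\mathfrak b=x_a(\mathfrak a_-*\mathfrak b)+x_b(\mathfrak a*\mathfrak b_-)+x_{a+b}(\mathfrak a_-*\mathfrak b_-)$. *)

theory Defs
  imports
    "HOL-Analysis.Analysis"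
    "HOL-Computational_Algebra.Computational_Algebra"
    "HOL-Library.Poly_Mapping"
begin

unbundle Formal_Laurent_Series.fps_syntax

section \<open>The fields\<close>

text \<open>
  The field with \<open>q\<close> elements is a type \<open>'a :: {field, finite}\<close> with \<open>q = CARD('a)\<close>;
  \<open>A\<close> is \<open>'a poly\<close> and \<open>K\<close> is \<open>'a poly fract\<close>. The completion of \<open>K\<close> at infinity is
  the field of formal Laurent series in \<open>1/\<theta>\<close>: it is \<open>'a fls\<close>, whose variable \<open>fls_X\<close>
  stands for \<open>1/\<theta>\<close>, so that \<open>\<theta>\<close> is \<open>fls_X_inv\<close> and the valuation is \<open>fls_subdegree\<close>.
\<close>

definition A_to_Kinf :: "'a::field poly \<Rightarrow> 'a fls" where
  "A_to_Kinf p = poly (map_poly fls_const p) fls_X_inv"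

lemma A_to_Kinf_0 [simp]: "A_to_Kinf 0 = 0"
  by (simp add: A_to_Kinf_def)

lemma A_to_Kinf_1 [simp]: "A_to_Kinf 1 = 1"
  by (simp add: A_to_Kinf_def)

lemma A_to_Kinf_pCons: "A_to_Kinf (pCons c p) = fls_const c + fls_X_inv * A_to_Kinf p"
  by (simp add: A_to_Kinf_def map_poly_pCons)

lemma A_to_Kinf_theta: "A_to_Kinf [:0, 1:] = fls_X_inv"
  by (simp add: A_to_Kinf_pCons)

lemma A_to_Kinf_add: "A_to_Kinf (p + r) = A_to_Kinf p + A_to_Kinf r"
proof -
  have "map_poly fls_const (p + r) = map_poly fls_const p + map_poly fls_const r"
    by (rule poly_eqI) (simp add: coeff_map_poly fls_plus_const)
  then show ?thesis by (simp add: A_to_Kinf_def)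
qed

lemma A_to_Kinf_smult: "A_to_Kinf (smult c p) = fls_const c * A_to_Kinf p"
  by (simp add: A_to_Kinf_def map_poly_smult fls_const_mult_const)

lemma A_to_Kinf_mult: "A_to_Kinf (p * r) = A_to_Kinf p * A_to_Kinf r"
proof (induction p)
  case 0
  then show ?case by simp
next
  case (pCons c p)
  have "A_to_Kinf (pCons c p * r) = A_to_Kinf (smult c r + pCons 0 (p * r))"
    by (simp only: mult_pCons_left)
  also have "\<dots> = (fls_const c + fls_X_inv * A_to_Kinf p) * A_to_Kinf r"
    unfolding A_to_Kinf_add A_to_Kinf_smult A_to_Kinf_pCons pCons.IH
    by (simp add: algebra_simps)
  finally show ?case by (simp add: A_to_Kinf_pCons)
qed

lemma A_to_Kinf_nth: "A_to_Kinf p $$ n = (if n \<le> 0 then coeff p (nat (- n)) else 0)"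
proof (induction p arbitrary: n)
  case 0
  then show ?case by simp
next
  case (pCons c p)
  have "nat (- n) = Suc (nat (- (n + 1)))" if "n < 0" using that by linarith
  then show ?case
    using pCons.IH[of "n + 1"]
    by (auto simp: A_to_Kinf_pCons fls_X_inv_times_conv_shift coeff_pCons split: nat.splits)
qed

lemma A_to_Kinf_eq_0_iff [simp]: "A_to_Kinf p = 0 \<longleftrightarrow> p = 0"
proof
  assume "A_to_Kinf p = 0"
  then have "coeff p n = 0" for n
    using A_to_Kinf_nth[of p "- int n"] by simp
  then show "p = 0" by (simp add: poly_eqI)
qed simp

lemma subdegree_A_to_Kinf: "fls_subdegree (A_to_Kinf p) = - int (degree p)"
proof (cases "p = 0")
  case False
  then show ?thesis
    by (intro fls_subdegree_eqI) (auto simp: A_to_Kinf_nth coeff_eq_0)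
qed simp

definition K_to_Kinf :: "'a::field poly fract \<Rightarrow> 'a fls" where
  "K_to_Kinf x = (THE z. \<forall>a b. b \<noteq> 0 \<longrightarrow> x = Fract a b \<longrightarrow> z = A_to_Kinf a / A_to_Kinf b)"

lemma K_to_Kinf_Fract:
  assumes "b \<noteq> 0"
  shows "K_to_Kinf (Fract a b) = A_to_Kinf a / A_to_Kinf b"
  unfolding K_to_Kinf_def
proof (rule the_equality)
  show "\<forall>a' b'. b' \<noteq> 0 \<longrightarrow> Fract a b = Fract a' b' \<longrightarrow>
      A_to_Kinf a / A_to_Kinf b = A_to_Kinf a' / A_to_Kinf b'"
    using assms by (auto simp: eq_fract frac_eq_eq A_to_Kinf_mult [symmetric])
qed (use assms in blast)

lemma K_to_Kinf_0 [simp]: "K_to_Kinf 0 = 0"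
  by (simp add: Zero_fract_def K_to_Kinf_Fract)

lemma K_to_Kinf_1 [simp]: "K_to_Kinf 1 = 1"
  by (simp add: One_fract_def K_to_Kinf_Fract)

lemma K_to_Kinf_add: "K_to_Kinf (x + y) = K_to_Kinf x + K_to_Kinf y"
  by (cases x; cases y)
    (simp add: K_to_Kinf_Fract A_to_Kinf_add A_to_Kinf_mult add_frac_eq)

lemma K_to_Kinf_mult: "K_to_Kinf (x * y) = K_to_Kinf x * K_to_Kinf y"
  by (cases x; cases y) (simp add: K_to_Kinf_Fract A_to_Kinf_mult)

lemma K_to_Kinf_eq_0_iff [simp]: "K_to_Kinf x = 0 \<longleftrightarrow> x = 0"
  by (cases x) (simp add: K_to_Kinf_Fract Zero_fract_def eq_fract)

definition Kinf_scale :: "'a::field poly fract \<Rightarrow> 'a fls \<Rightarrow> 'a fls" where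
  "Kinf_scale c z = K_to_Kinf c * z"

global_interpretation Kinf: vector_space Kinf_scale
  defines Kinf_span = Kinf.span
  by unfold_locales (simp_all add: Kinf_scale_def K_to_Kinf_add K_to_Kinf_mult algebra_simps)

text \<open>The two lemmas below say that \<open>'a fls\<close> is indeed the completion of \<open>K\<close> at infinity.\<close>

lemma dist_fls_less_iff:
  fixes f g :: "'a::ab_group_add fls"
  shows "dist f g < inverse (2 ^ N) \<longleftrightarrow> (\<forall>k \<le> int N. f $$ k = g $$ k)"
proof (cases "f = g")
  case False
  define d where "d = fls_subdegree (f - g)"
  have nz: "f - g \<noteq> 0" using False by simp
  have "dist f g < inverse (2 ^ N) \<longleftrightarrow> int N < d"
  proof (cases "d \<ge> 0")
    case True
    have "dist f g = inverse (2 ^ nat d)"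
      using False True by (simp add: dist_fls_def d_def)
    then have "dist f g < inverse (2 ^ N) \<longleftrightarrow> (2::real) ^ N < 2 ^ nat d"
      by simp
    also have "\<dots> \<longleftrightarrow> int N < d" using True by (simp add: zless_nat_conj nat_less_iff) linarith
    finally show ?thesis .
  next
    case neg: False
    have "dist f g = 2 ^ nat (- d)"
      using False neg by (simp add: dist_fls_def d_def)
    moreover have "(1::real) \<le> 2 ^ nat (- d)" by simp
    moreover have "inverse (2 ^ N) \<le> (1::real)" by (simp add: inverse_le_1_iff)
    ultimately show ?thesis using neg by linarith
  qed
  also have "\<dots> \<longleftrightarrow> (\<forall>k \<le> int N. (f - g) $$ k = 0)"
  proof
    assume "int N < d"
    then show "\<forall>k \<le> int N. (f - g) $$ k = 0"
      using fls_eq0_below_subdegree[of _ "f - g"] unfolding d_def by auto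
  next
    assume "\<forall>k \<le> int N. (f - g) $$ k = 0"
    then show "int N < d"
      using nth_fls_subdegree_nonzero[OF nz] unfolding d_def by (metis not_le)
  qed
  finally show ?thesis by simp
qed simp

lemma ex_inverse_power2_less:
  assumes "e > (0::real)"
  obtains N :: nat where "inverse (2 ^ N) < e"
  using real_arch_pow_inv[OF assms, of "1/2"] by (auto simp: power_one_over inverse_eq_divide)

lemma closure_range_K_to_Kinf: "closure (range K_to_Kinf) = (UNIV :: 'a::field fls set)"
proof (intro set_eqI iffI UNIV_I)
  fix f :: "'a fls"
  show "f \<in> closure (range K_to_Kinf)"
    unfolding closure_approachable
  proof (intro allI impI)
    fix e :: real assume "e > 0"
    then obtain N :: nat where N: "inverse (2 ^ N) < e" by (rule ex_inverse_power2_less)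
    define M where "M = nat (int N - fls_subdegree f)"
    define p where "p = Abs_poly (\<lambda>i. if i \<le> M then f $$ (int N - int i) else 0)"
    have cp: "coeff p i = (if i \<le> M then f $$ (int N - int i) else 0)" for i
      unfolding p_def by (rule coeff_Abs_poly[of M, THEN fun_cong[of _ _ i], simplified]) simp
    define x where "x = Fract p ([:0, 1:] ^ N)"
    have "A_to_Kinf ([:0, 1:] ^ N) = (fls_X_inv ^ N :: 'a fls)"
      by (induction N) (simp_all add: A_to_Kinf_mult A_to_Kinf_theta del: mult_pCons_left)
    then have "K_to_Kinf x = fls_shift (- int N) (A_to_Kinf p)"
      by (simp add: x_def K_to_Kinf_Fract)
    then have "\<forall>k \<le> int N. K_to_Kinf x $$ k = f $$ k"
      by (auto simp: A_to_Kinf_nth cp M_def)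
    then have "dist (K_to_Kinf x) f < inverse (2 ^ N)"
      by (simp add: dist_fls_less_iff)
    with N have "dist (K_to_Kinf x) f < e" by linarith
    then show "\<exists>y\<in>range K_to_Kinf. dist y f < e" by blast
  qed
qed

lemma Cauchy_fls_convergent:
  fixes F :: "nat \<Rightarrow> 'a::ab_group_add fls"
  assumes "Cauchy F"
  shows "convergent F"
proof -
  have "\<exists>M. \<forall>m\<ge>M. \<forall>n\<ge>M. dist (F m) (F n) < inverse (2 ^ N)" for N :: nat
    using assms unfolding Cauchy_def by simp
  then obtain M where M: "\<And>N m n. m \<ge> M N \<Longrightarrow> n \<ge> M N \<Longrightarrow> dist (F m) (F n) < inverse (2 ^ N)"
    by metis
  define L where "L k = F (M (nat k)) $$ k" for k :: int
  have L: "F m $$ k = L k" if "k \<le> int N" "m \<ge> M N" for N m k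
  proof -
    define m' where "m' = max (M N) (M (nat k))"
    have "F m $$ k = F m' $$ k"
      using M[of N m m'] that by (auto simp: dist_fls_less_iff m'_def)
    moreover have "F (M (nat k)) $$ k = F m' $$ k"
      using M[of "nat k" "M (nat k)" m'] by (auto simp: dist_fls_less_iff m'_def)
    ultimately show ?thesis by (simp add: L_def)
  qed
  define l where "l = Abs_fls L"
  have "L k = 0" if "k < min 0 (fls_subdegree (F (M 0)))" for k
    using that L[of k 0 "M 0"] by simp
  then have l: "l $$ k = L k" for k
    unfolding l_def by (intro nth_Abs_fls_lower_bound) blast
  have "F \<longlonglongrightarrow> l"
    unfolding lim_sequentially
  proof (intro allI impI)
    fix e :: real assume "e > 0"
    then obtain N :: nat where N: "inverse (2 ^ N) < e" by (rule ex_inverse_power2_less)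
    have "dist (F n) l < inverse (2 ^ N)" if "n \<ge> M N" for n
      using that by (simp add: dist_fls_less_iff l L)
    with N show "\<exists>no. \<forall>n\<ge>no. dist (F n) l < e" by (meson less_trans)
  qed
  then show ?thesis by (rule convergentI)
qed

section \<open>Words\<close>

text \<open>
  The type of positive integers serves both as index set of the alphabet and as set of
  arguments of zeta values, so that a word is the same thing as a tuple of positive integers.
\<close>

typedef pnat = "{n::nat. n > 0}"
  morphisms nat_of_pnat pnat_of_nat
  by blast

setup_lifting type_definition_pnat

instantiation pnat :: ab_semigroup_add
begin

lift_definition plus_pnat :: "pnat \<Rightarrow> pnat \<Rightarrow> pnat" is "(+)"
  by simp

instance
  by standard (transfer; simp)+

end

lemma nat_of_pnat_pos: "nat_of_pnat n > 0"
  by transfer simp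

type_synonym word = "pnat list"

section \<open>Power sums\<close>

definition zeta_A :: "word \<Rightarrow> 'a::{field,finite} fls" where
  "zeta_A s =
     (\<Sum>\<^sub>\<infinity>as \<in> {as :: 'a poly list. length as = length s \<and> (\<forall>a\<in>set as. lead_coeff a = 1) \<and>
                  sorted_wrt (\<lambda>a b. degree a > degree b) as}.
        \<Prod>i<length s. inverse (A_to_Kinf (as ! i) ^ nat_of_pnat (s ! i)))"

definition MZV_space :: "'a::{field,finite} fls set" where
  "MZV_space = Kinf_span (range zeta_A)"

definition ell :: "nat \<Rightarrow> 'a::{field,finite} poly" where
  "ell d = (\<Prod>i=1..d. [:0, 1:] - [:0, 1:] ^ (CARD('a) ^ i))"

definition Li :: "word \<Rightarrow> 'a::{field,finite} fls" where
  "Li s =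
     (\<Sum>\<^sub>\<infinity>ds \<in> {ds :: nat list. length ds = length s \<and> sorted_wrt (>) ds}.
        \<Prod>i<length s. inverse (A_to_Kinf (ell (ds ! i) :: 'a poly) ^ nat_of_pnat (s ! i)))"

text \<open>Both families are summable, so that the infinite sums above have their proper meaning.\<close>

lemma fls_summable_on:
  fixes f :: "'b \<Rightarrow> 'a::ab_group_add fls"
  assumes "\<And>N::nat. finite {x \<in> X. \<exists>k \<le> int N. f x $$ k \<noteq> 0}"
  shows "f summable_on X"
proof -
  define E where "E N = {x \<in> X. \<exists>k \<le> int N. f x $$ k \<noteq> 0}" for N :: nat
  have fin: "finite (E N)" for N using assms unfolding E_def .
  define L where "L k = (\<Sum>x\<in>E (nat k). f x $$ k)" for k :: int
  define m where "m = Min (insert 0 ((\<lambda>x. fls_subdegree (f x)) ` E 0))"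
  have "L k = 0" if "k < m" for k
  proof -
    have k: "k < 0" and "\<forall>x\<in>E 0. k < fls_subdegree (f x)"
      using that fin by (auto simp: m_def)
    then show ?thesis by (simp add: L_def)
  qed
  then have l: "Abs_fls L $$ k = L k" for k
    by (intro nth_Abs_fls_lower_bound) blast
  have nth_sum: "(\<Sum>x\<in>Y. f x) $$ k = (\<Sum>x\<in>Y. f x $$ k)" for Y k
    by (induction Y rule: infinite_finite_induct) auto
  have "(f has_sum Abs_fls L) X"
    unfolding has_sum_def tendsto_iff
  proof (intro allI impI)
    fix e :: real assume "e > 0"
    then obtain N :: nat where N: "inverse (2 ^ N) < e" by (rule ex_inverse_power2_less)
    have "dist (sum f Y) (Abs_fls L) < e" if Y: "finite Y" "E N \<subseteq> Y" "Y \<subseteq> X" for Y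
    proof -
      have "sum f Y $$ k = L k" if "k \<le> int N" for k
      proof -
        have "int (nat k) \<le> int N" using that by simp
        then have "E (nat k) \<subseteq> E N" unfolding E_def using order_trans by blast
        with Y fin have "(\<Sum>x\<in>Y. f x $$ k) = (\<Sum>x\<in>E (nat k). f x $$ k)"
          by (intro sum.mono_neutral_right) (auto simp: E_def not_le intro: less_imp_le)
        then show ?thesis by (simp add: nth_sum L_def)
      qed
      then have "dist (sum f Y) (Abs_fls L) < inverse (2 ^ N)"
        by (simp add: dist_fls_less_iff l)
      with N show ?thesis by linarith
    qed
    moreover have "E N \<subseteq> X" by (auto simp: E_def)
    ultimately show "\<forall>\<^sub>F Y in finite_subsets_at_top X. dist (sum f Y) (Abs_fls L) < e"
      unfolding eventually_finite_subsets_at_top using fin by blast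
  qed
  then show ?thesis by (auto simp: summable_on_def)
qed

lemma degree_le_of_power_product_nth:
  fixes P :: "nat \<Rightarrow> 'a::field poly"
  assumes "(\<Prod>i<n. inverse (A_to_Kinf (P i) ^ nat_of_pnat (t i))) $$ k \<noteq> 0" "k \<le> int N" "i < n"
  shows "degree (P i) \<le> N"
proof -
  let ?f = "\<Prod>i<n. inverse (A_to_Kinf (P i) ^ nat_of_pnat (t i))"
  have nz: "P j \<noteq> 0" if "j < n" for j
  proof
    assume "P j = 0"
    then have "?f = 0" using that nat_of_pnat_pos[of "t j"] by auto
    with assms show False by simp
  qed
  have sub: "(\<And>j. j \<in> J \<Longrightarrow> g j \<noteq> 0) \<Longrightarrow>
      fls_subdegree (\<Prod>j\<in>J. g j) = (\<Sum>j\<in>J. fls_subdegree (g j))"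
    for J :: "nat set" and g :: "nat \<Rightarrow> 'a fls"
    by (induction J rule: infinite_finite_induct) auto
  have "fls_subdegree ?f = (\<Sum>j<n. fls_subdegree (inverse (A_to_Kinf (P j) ^ nat_of_pnat (t j))))"
    by (rule sub) (use nz in auto)
  also have "\<dots> = (\<Sum>j<n. int (nat_of_pnat (t j) * degree (P j)))"
    by (intro sum.cong refl) (simp add: fls_inverse_subdegree fls_subdegree_pow subdegree_A_to_Kinf)
  finally have "(\<Sum>j<n. int (nat_of_pnat (t j) * degree (P j))) \<le> int N"
    using fls_subdegree_leI[OF assms(1)] assms(2) by linarith
  moreover have "int (nat_of_pnat (t i) * degree (P i)) \<le> (\<Sum>j<n. int (nat_of_pnat (t j) * degree (P j)))"
    using assms(3) by (intro member_le_sum) auto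
  moreover have "degree (P i) \<le> nat_of_pnat (t i) * degree (P i)"
    using nat_of_pnat_pos[of "t i"] by simp
  ultimately show ?thesis by linarith
qed

lemma finite_degree_le: "finite {p :: 'a::{field,finite} poly. degree p \<le> N}"
proof (rule finite_subset)
  show "{p :: 'a poly. degree p \<le> N} \<subseteq> Poly ` {xs. set xs \<subseteq> UNIV \<and> length xs \<le> Suc N}"
  proof
    fix p :: "'a poly" assume "p \<in> {p. degree p \<le> N}"
    then have "length (coeffs p) \<le> Suc N" by (simp add: coeffs_def)
    then show "p \<in> Poly ` {xs. set xs \<subseteq> UNIV \<and> length xs \<le> Suc N}"
      by (intro image_eqI[of _ _ "coeffs p"]) auto
  qed
qed (intro finite_imageI finite_lists_length_le finite)

lemma zeta_A_summable:
  "(\<lambda>as. \<Prod>i<length s. inverse (A_to_Kinf (as ! i) ^ nat_of_pnat (s ! i))) summable_on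
     {as :: 'a::{field,finite} poly list. length as = length s \<and> (\<forall>a\<in>set as. lead_coeff a = 1) \<and>
        sorted_wrt (\<lambda>a b. degree a > degree b) as}"
proof (rule fls_summable_on, rule finite_subset)
  fix N :: nat
  show "finite {as :: 'a poly list. set as \<subseteq> {p. degree p \<le> N} \<and> length as = length s}"
    by (intro finite_lists_length_eq finite_degree_le)
qed (auto simp: in_set_conv_nth dest: degree_le_of_power_product_nth)

lemma CARD_field_ge_2: "CARD('a::{field,finite}) \<ge> 2"
  using card_mono[of "UNIV :: 'a set" "{0, 1}"] by simp

lemma degree_ell: "degree (ell d :: 'a::{field,finite} poly) \<ge> d"
proof -
  let ?t = "[:0, 1:] :: 'a poly"
  have deg: "degree (?t - ?t ^ (CARD('a) ^ i)) = CARD('a) ^ i" if "i \<ge> 1" for i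
  proof -
    have "1 < CARD('a) ^ i"
      using CARD_field_ge_2[where 'a='a] that by (intro one_less_power) auto
    moreover have "degree (- (?t ^ (CARD('a) ^ i))) = CARD('a) ^ i"
      by (simp add: degree_power_eq)
    ultimately show ?thesis
      using degree_add_eq_right[of ?t "- (?t ^ (CARD('a) ^ i))"] by simp
  qed
  have nz: "?t - ?t ^ (CARD('a) ^ i) \<noteq> 0" if "i \<ge> 1" for i
    using deg[OF that] by (metis degree_0 power_not_zero zero_neq_numeral CARD_field_ge_2 not_numeral_le_zero)
  have "degree (ell d :: 'a poly) = (\<Sum>i=1..d. degree (?t - ?t ^ (CARD('a) ^ i)))"
    unfolding ell_def using nz by (intro degree_prod_eq_sum_degree) auto
  also have "\<dots> = (\<Sum>i=1..d. CARD('a) ^ i)"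
    by (intro sum.cong refl deg) auto
  also have "\<dots> \<ge> (\<Sum>i=1..d. 1)"
    by (intro sum_mono) simp
  finally show ?thesis by simp
qed

lemma Li_summable:
  "(\<lambda>ds. \<Prod>i<length s. inverse (A_to_Kinf (ell (ds ! i) :: 'a::{field,finite} poly) ^ nat_of_pnat (s ! i)))
     summable_on {ds :: nat list. length ds = length s \<and> sorted_wrt (>) ds}"
proof (rule fls_summable_on, rule finite_subset)
  fix N :: nat
  show "finite {ds :: nat list. set ds \<subseteq> {..N} \<and> length ds = length s}"
    by (intro finite_lists_length_eq) simp
next
  fix N :: nat
  let ?f = "\<lambda>ds. \<Prod>i<length s. inverse (A_to_Kinf (ell (ds ! i) :: 'a poly) ^ nat_of_pnat (s ! i))"
  have "d \<le> N" if "?f ds $$ k \<noteq> 0" "k \<le> int N" "length ds = length s" "d \<in> set ds" for ds k d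
  proof -
    obtain i where i: "i < length s" "d = ds ! i"
      using \<open>d \<in> set ds\<close> \<open>length ds = length s\<close> by (metis in_set_conv_nth)
    have "degree (ell (ds ! i) :: 'a poly) \<le> N"
      using degree_le_of_power_product_nth[OF that(1,2) i(1)] .
    then show ?thesis using degree_ell[of d, where 'a='a] i by simp
  qed
  then show "{ds \<in> {ds. length ds = length s \<and> sorted_wrt (>) ds}. \<exists>k\<le>int N. ?f ds $$ k \<noteq> 0}
      \<subseteq> {ds. set ds \<subseteq> {..N} \<and> length ds = length s}"
    by blast
qed

section \<open>The stuffle algebra\<close>

text \<open>
  For a field \<open>'k\<close>, the type \<open>word \<Rightarrow>\<^sub>0 'k\<close> of finitely supported functions is the \<open>'k\<close>-vector
  space with basis the words, the word \<open>w\<close> being \<open>single w 1\<close>. With \<open>'k = 'a\<close> it is the space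
  \<open>C\<close>; its extension of scalars to \<open>K\<close> is \<open>word \<Rightarrow>\<^sub>0 'a poly fract\<close>, where the pure tensor
  of \<open>u\<close> and \<open>c\<close> is \<open>pm_scale c (base_change u)\<close>.
\<close>

definition pm_scale :: "'k::field \<Rightarrow> ('w \<Rightarrow>\<^sub>0 'k) \<Rightarrow> ('w \<Rightarrow>\<^sub>0 'k)" where
  "pm_scale c u = Poly_Mapping.map ((*) c) u"

lemma lookup_pm_scale [simp]: "Poly_Mapping.lookup (pm_scale c u) w = c * Poly_Mapping.lookup u w"
  by (simp add: pm_scale_def Poly_Mapping.map.rep_eq when_def)

global_interpretation pm: vector_space pm_scale
  by unfold_locales (auto intro!: poly_mapping_eqI simp: lookup_add algebra_simps)

text \<open>The linear map with prescribed values on the basis of words; \<open>s\<close> is the scalar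
  multiplication of the target.\<close>

definition lin_ext :: "('k::field \<Rightarrow> 'm \<Rightarrow> 'm) \<Rightarrow> ('w \<Rightarrow> 'm) \<Rightarrow> ('w \<Rightarrow>\<^sub>0 'k) \<Rightarrow> 'm::ab_group_add" where
  "lin_ext s f u = (\<Sum>w\<in>Poly_Mapping.keys u. s (Poly_Mapping.lookup u w) (f w))"

definition bilin_ext ::
    "('k::field \<Rightarrow> 'm \<Rightarrow> 'm) \<Rightarrow> ('w \<Rightarrow> 'w \<Rightarrow> 'm) \<Rightarrow> ('w \<Rightarrow>\<^sub>0 'k) \<Rightarrow> ('w \<Rightarrow>\<^sub>0 'k) \<Rightarrow> 'm::ab_group_add" where
  "bilin_ext s f u v = lin_ext s (\<lambda>x. lin_ext s (f x) v) u"

definition prepend :: "pnat \<Rightarrow> (word \<Rightarrow>\<^sub>0 'k) \<Rightarrow> (word \<Rightarrow>\<^sub>0 'k::field)" where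
  "prepend a = lin_ext pm_scale (\<lambda>w. Poly_Mapping.single (a # w) 1)"

fun stuffle_word :: "word \<Rightarrow> word \<Rightarrow> (word \<Rightarrow>\<^sub>0 'k::field)" where
  "stuffle_word [] v = Poly_Mapping.single v 1"
| "stuffle_word u [] = Poly_Mapping.single u 1"
| "stuffle_word (a # u) (b # v) =
     prepend a (stuffle_word u (b # v)) + prepend b (stuffle_word (a # u) v)
       + prepend (a + b) (stuffle_word u v)"

definition stuffle :: "(word \<Rightarrow>\<^sub>0 'k) \<Rightarrow> (word \<Rightarrow>\<^sub>0 'k) \<Rightarrow> (word \<Rightarrow>\<^sub>0 'k::field)" where
  "stuffle = bilin_ext pm_scale stuffle_word"

definition base_change :: "(word \<Rightarrow>\<^sub>0 'a) \<Rightarrow> (word \<Rightarrow>\<^sub>0 'a::field poly fract)" where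
  "base_change u = Poly_Mapping.map (\<lambda>c. Fract [:c:] 1) u"

definition stuffle_K ::
    "(word \<Rightarrow>\<^sub>0 'a poly fract) \<Rightarrow> (word \<Rightarrow>\<^sub>0 'a poly fract) \<Rightarrow> (word \<Rightarrow>\<^sub>0 'a::field poly fract)" where
  "stuffle_K = bilin_ext pm_scale
     (\<lambda>u v. base_change (stuffle (Poly_Mapping.single u (1::'a)) (Poly_Mapping.single v 1)))"

definition Zstar :: "(word \<Rightarrow>\<^sub>0 'a::{field,finite} poly fract) \<Rightarrow> 'a fls" where
  "Zstar = lin_ext Kinf_scale Li"

text \<open>The remaining lemmas establish that \<open>stuffle_K\<close> makes \<open>word \<Rightarrow>\<^sub>0 'a poly fract\<close> a
  commutative \<open>K\<close>-algebra and extends the product of \<open>C\<close>.\<close>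

lemma lin_ext_superset:
  assumes "vector_space s" "finite W" "Poly_Mapping.keys u \<subseteq> W"
  shows "lin_ext s f u = (\<Sum>w\<in>W. s (Poly_Mapping.lookup u w) (f w))"
proof -
  interpret vector_space s by fact
  show ?thesis
    unfolding lin_ext_def using assms by (intro sum.mono_neutral_left) (auto simp: in_keys_iff)
qed

lemma linear_lin_ext:
  fixes s :: "'k::field \<Rightarrow> 'm::ab_group_add \<Rightarrow> 'm" and f :: "'w \<Rightarrow> 'm"
  assumes "vector_space s"
  shows "Vector_Spaces.linear pm_scale s (lin_ext s f)"
proof -
  interpret vector_space s by fact
  show ?thesis
  proof unfold_locales
    fix u v :: "'w \<Rightarrow>\<^sub>0 'k"
    let ?W = "Poly_Mapping.keys u \<union> Poly_Mapping.keys v"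
    have "Poly_Mapping.keys (u + v) \<subseteq> ?W" by (rule Poly_Mapping.keys_add)
    then show "lin_ext s f (u + v) = lin_ext s f u + lin_ext s f v"
      by (simp add: lin_ext_superset[OF assms, of ?W] lookup_add scale_left_distrib sum.distrib)
  next
    fix c and u :: "'w \<Rightarrow>\<^sub>0 'k"
    have "Poly_Mapping.keys (pm_scale c u) \<subseteq> Poly_Mapping.keys u" by (auto simp: in_keys_iff)
    then show "lin_ext s f (pm_scale c u) = s c (lin_ext s f u)"
      by (simp add: lin_ext_superset[OF assms, of "Poly_Mapping.keys u"] scale_sum_right)
  qed
qed

lemma lin_ext_single [simp]:
  assumes "vector_space s"
  shows "lin_ext s f (Poly_Mapping.single w 1) = f w"
proof -
  interpret vector_space s by fact
  show ?thesis by (simp add: lin_ext_def)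
qed

lemma linear_eq_lin_ext:
  assumes "Vector_Spaces.linear pm_scale s g"
  shows "g u = lin_ext s (\<lambda>w. g (Poly_Mapping.single w 1)) u"
proof -
  interpret Vector_Spaces.linear pm_scale s g by fact
  have "u = (\<Sum>w\<in>Poly_Mapping.keys u. pm_scale (Poly_Mapping.lookup u w) (Poly_Mapping.single w 1))"
    by (rule poly_mapping_eqI)
      (simp add: lookup_sum lookup_single when_def if_distrib in_keys_iff cong: if_cong)
  from arg_cong[OF this, of g] show ?thesis
    by (simp only: sum scale lin_ext_def)
qed

lemma linear_eqI:
  assumes "Vector_Spaces.linear pm_scale s g" "Vector_Spaces.linear pm_scale s h"
    and "\<And>w. g (Poly_Mapping.single w 1) = h (Poly_Mapping.single w 1)"
  shows "g u = h u"
  unfolding linear_eq_lin_ext[OF assms(1), of u] linear_eq_lin_ext[OF assms(2), of u] assms(3) ..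

lemma lin_ext_add: "vector_space s \<Longrightarrow> lin_ext s f (u + v) = lin_ext s f u + lin_ext s f v"
  using linear_lin_ext[of s f] by (simp add: Vector_Spaces.linear_def module_hom_def module_hom_axioms_def)

lemma lin_ext_scale: "vector_space s \<Longrightarrow> lin_ext s f (pm_scale c u) = s c (lin_ext s f u)"
  using linear_lin_ext[of s f] by (simp add: Vector_Spaces.linear_def module_hom_def module_hom_axioms_def)

lemma lin_ext_add_fun:
  assumes "vector_space s"
  shows "lin_ext s (\<lambda>x. f x + g x) u = lin_ext s f u + lin_ext s g u"
proof -
  interpret vector_space s by fact
  show ?thesis by (simp add: lin_ext_def scale_right_distrib sum.distrib)
qed

lemma lin_ext_scale_fun:
  assumes "vector_space s"
  shows "lin_ext s (\<lambda>x. s c (f x)) u = s c (lin_ext s f u)"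
proof -
  interpret vector_space s by fact
  show ?thesis by (simp add: lin_ext_def scale_sum_right mult.commute)
qed

lemma linear_pmI:
  fixes g :: "('w \<Rightarrow>\<^sub>0 'k::field) \<Rightarrow> ('v \<Rightarrow>\<^sub>0 'k)"
  assumes "\<And>u v. g (u + v) = g u + g v" "\<And>c u. g (pm_scale c u) = pm_scale c (g u)"
  shows "Vector_Spaces.linear pm_scale pm_scale g"
  by unfold_locales (rule assms)+

lemma prepend_add: "prepend a (u + v) = prepend a u + prepend a v"
  by (simp add: prepend_def lin_ext_add pm.vector_space_axioms)

lemma prepend_scale: "prepend a (pm_scale c u) = pm_scale c (prepend a u)"
  by (simp add: prepend_def lin_ext_scale pm.vector_space_axioms)

lemma prepend_single: "prepend a (Poly_Mapping.single w 1) = Poly_Mapping.single (a # w) 1"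
  by (simp add: prepend_def pm.vector_space_axioms)

lemma stuffle_add_left: "stuffle (u + u') v = stuffle u v + stuffle u' v"
  by (simp add: stuffle_def bilin_ext_def lin_ext_add pm.vector_space_axioms)

lemma stuffle_scale_left: "stuffle (pm_scale c u) v = pm_scale c (stuffle u v)"
  by (simp add: stuffle_def bilin_ext_def lin_ext_scale pm.vector_space_axioms)

lemma stuffle_add_right: "stuffle u (v + v') = stuffle u v + stuffle u v'"
  by (simp add: stuffle_def bilin_ext_def lin_ext_add lin_ext_add_fun pm.vector_space_axioms)

lemma stuffle_scale_right: "stuffle u (pm_scale c v) = pm_scale c (stuffle u v)"
  by (simp add: stuffle_def bilin_ext_def lin_ext_scale pm.vector_space_axioms
      lin_ext_scale_fun[OF pm.vector_space_axioms])

lemmas stuffle_bilinear =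
  stuffle_add_left stuffle_scale_left stuffle_add_right stuffle_scale_right

lemma stuffle_single:
  "stuffle (Poly_Mapping.single u 1) (Poly_Mapping.single v 1) = stuffle_word u v"
  by (simp add: stuffle_def bilin_ext_def pm.vector_space_axioms)

lemma stuffle_word_Nil_right [simp]: "stuffle_word u [] = Poly_Mapping.single u 1"
  by (cases u) simp_all

lemma stuffle_word_commute: "stuffle_word u v = stuffle_word v u"
  by (induction u v rule: stuffle_word.induct) (simp_all add: add_ac)

lemma stuffle_commute: "stuffle u v = stuffle v u"
proof (rule linear_eqI[where u = u])
  fix x :: word
  show "stuffle (Poly_Mapping.single x 1) v = stuffle v (Poly_Mapping.single x 1)"
  proof (rule linear_eqI[where u = v])
    fix y :: word
    show "stuffle (Poly_Mapping.single x 1) (Poly_Mapping.single y 1) =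
        stuffle (Poly_Mapping.single y 1) (Poly_Mapping.single x 1)"
      by (simp add: stuffle_single stuffle_word_commute[of x])
  qed (rule linear_pmI; simp add: stuffle_bilinear)+
qed (rule linear_pmI; simp add: stuffle_bilinear)+

lemma stuffle_Nil_left [simp]: "stuffle (Poly_Mapping.single [] 1) u = u"
  by (rule linear_eqI[where u = u]) (rule linear_pmI | simp add: stuffle_bilinear stuffle_single)+

lemma stuffle_Nil_right [simp]: "stuffle u (Poly_Mapping.single [] 1) = u"
  by (simp add: stuffle_commute[of u])

lemma stuffle_prepend:
  "stuffle (prepend a u) (prepend b v) =
     prepend a (stuffle u (prepend b v)) + prepend b (stuffle (prepend a u) v)
       + prepend (a + b) (stuffle u v)"
proof (rule linear_eqI[where u = u])
  fix x :: word
  let ?x = "Poly_Mapping.single x 1"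
  show "stuffle (prepend a ?x) (prepend b v) =
      prepend a (stuffle ?x (prepend b v)) + prepend b (stuffle (prepend a ?x) v)
        + prepend (a + b) (stuffle ?x v)"
  proof (rule linear_eqI[where u = v])
    fix y :: word
    let ?y = "Poly_Mapping.single y 1"
    show "stuffle (prepend a ?x) (prepend b ?y) =
        prepend a (stuffle ?x (prepend b ?y)) + prepend b (stuffle (prepend a ?x) ?y)
          + prepend (a + b) (stuffle ?x ?y)"
      by (simp add: prepend_single stuffle_single)
  qed (rule linear_pmI;
      simp add: stuffle_bilinear prepend_add prepend_scale pm.scale_right_distrib)+
qed (rule linear_pmI;
      simp add: stuffle_bilinear prepend_add prepend_scale pm.scale_right_distrib)+

lemma stuffle_assoc_single:
  fixes x y z :: word
  defines "X \<equiv> Poly_Mapping.single x (1::'k::field)"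
    and "Y \<equiv> Poly_Mapping.single y 1" and "Z \<equiv> Poly_Mapping.single z 1"
  shows "stuffle (stuffle X Y) Z = stuffle X (stuffle Y Z)"
  unfolding X_def Y_def Z_def
proof (induction "length x + length y + length z" arbitrary: x y z rule: less_induct)
  case less
  let ?w = "\<lambda>w. Poly_Mapping.single w 1 :: word \<Rightarrow>\<^sub>0 'k"
  show ?case
  proof (cases "x = [] \<or> y = [] \<or> z = []")
    case True
    then show ?thesis by auto
  next
    case False
    then obtain a x' b y' c z' where eq: "x = a # x'" "y = b # y'" "z = c # z'"
      by (meson neq_Nil_conv)
    define P where "P = prepend a (?w x')"
    define Q where "Q = prepend b (?w y')"
    define R where "R = prepend c (?w z')"
    have w: "?w x = P" "?w y = Q" "?w z = R"
      by (simp_all add: eq P_def Q_def R_def prepend_single)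
    have IH:
      "stuffle (stuffle (?w x') Q) R = stuffle (?w x') (stuffle Q R)"
      "stuffle (stuffle P (?w y')) R = stuffle P (stuffle (?w y') R)"
      "stuffle (stuffle P Q) (?w z') = stuffle P (stuffle Q (?w z'))"
      "stuffle (stuffle (?w x') (?w y')) R = stuffle (?w x') (stuffle (?w y') R)"
      "stuffle (stuffle (?w x') Q) (?w z') = stuffle (?w x') (stuffle Q (?w z'))"
      "stuffle (stuffle P (?w y')) (?w z') = stuffle P (stuffle (?w y') (?w z'))"
      "stuffle (stuffle (?w x') (?w y')) (?w z') = stuffle (?w x') (stuffle (?w y') (?w z'))"
      unfolding w[symmetric] by (rule less; simp add: eq)+
    have PQ: "stuffle P Q = prepend a (stuffle (?w x') Q) + prepend b (stuffle P (?w y'))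
        + prepend (a + b) (stuffle (?w x') (?w y'))"
      unfolding P_def Q_def by (rule stuffle_prepend)
    have QR: "stuffle Q R = prepend b (stuffle (?w y') R) + prepend c (stuffle Q (?w z'))
        + prepend (b + c) (stuffle (?w y') (?w z'))"
      unfolding Q_def R_def by (rule stuffle_prepend)
    have R: "stuffle (prepend d U) R = prepend d (stuffle U R) + prepend c (stuffle (prepend d U) (?w z'))
        + prepend (d + c) (stuffle U (?w z'))" for d U
      unfolding R_def by (rule stuffle_prepend)
    have P: "stuffle P (prepend d U) = prepend a (stuffle (?w x') (prepend d U))
        + prepend d (stuffle P U) + prepend (a + d) (stuffle (?w x') U)" for d U
      unfolding P_def by (rule stuffle_prepend)
    have "stuffle (stuffle P Q) R =
        prepend a (stuffle (stuffle (?w x') Q) R) + prepend b (stuffle (stuffle P (?w y')) R)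
        + prepend (a + b) (stuffle (stuffle (?w x') (?w y')) R)
        + prepend c (stuffle (stuffle P Q) (?w z'))
        + prepend (a + c) (stuffle (stuffle (?w x') Q) (?w z'))
        + prepend (b + c) (stuffle (stuffle P (?w y')) (?w z'))
        + prepend (a + b + c) (stuffle (stuffle (?w x') (?w y')) (?w z'))"
      unfolding PQ stuffle_add_left R prepend_add by (simp only: add_ac)
    also have "\<dots> =
        prepend a (stuffle (?w x') (stuffle Q R)) + prepend b (stuffle P (stuffle (?w y') R))
        + prepend (a + b) (stuffle (?w x') (stuffle (?w y') R))
        + prepend c (stuffle P (stuffle Q (?w z')))
        + prepend (a + c) (stuffle (?w x') (stuffle Q (?w z')))
        + prepend (b + c) (stuffle P (stuffle (?w y') (?w z')))
        + prepend (a + b + c) (stuffle (?w x') (stuffle (?w y') (?w z')))"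
      unfolding IH ..
    also have "\<dots> = stuffle P (stuffle Q R)"
      unfolding QR stuffle_add_right P prepend_add by (simp only: add_ac)
    finally show ?thesis unfolding w .
  qed
qed

lemma stuffle_assoc: "stuffle (stuffle u v) w = stuffle u (stuffle v w)"
proof (rule linear_eqI[where u = u])
  fix x :: word
  let ?x = "Poly_Mapping.single x 1"
  show "stuffle (stuffle ?x v) w = stuffle ?x (stuffle v w)"
  proof (rule linear_eqI[where u = v])
    fix y :: word
    let ?y = "Poly_Mapping.single y 1"
    show "stuffle (stuffle ?x ?y) w = stuffle ?x (stuffle ?y w)"
    proof (rule linear_eqI[where u = w])
      fix z :: word
      let ?z = "Poly_Mapping.single z 1"
      show "stuffle (stuffle ?x ?y) ?z = stuffle ?x (stuffle ?y ?z)"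
        by (rule stuffle_assoc_single)
    qed (rule linear_pmI; simp add: stuffle_bilinear)+
  qed (rule linear_pmI; simp add: stuffle_bilinear)+
qed (rule linear_pmI; simp add: stuffle_bilinear)+

lemma lookup_base_change [simp]:
  "Poly_Mapping.lookup (base_change u) w = Fract [:Poly_Mapping.lookup u w:] 1"
  by (simp add: base_change_def Poly_Mapping.map.rep_eq when_def Zero_fract_def)

lemma base_change_add: "base_change (u + v) = base_change u + base_change v"
  by (rule poly_mapping_eqI) (simp add: lookup_add)

lemma base_change_scale: "base_change (pm_scale c u) = pm_scale (Fract [:c:] 1) (base_change u)"
  by (rule poly_mapping_eqI) (simp add: mult.commute)

lemma base_change_single [simp]:
  "base_change (Poly_Mapping.single w 1) = Poly_Mapping.single w 1"
  by (rule poly_mapping_eqI)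
    (simp add: lookup_single when_def One_fract_def Zero_fract_def one_pCons)

lemma base_change_lin_ext:
  "base_change (lin_ext pm_scale f u) = lin_ext pm_scale (\<lambda>w. base_change (f w)) (base_change u)"
proof -
  have keys: "Poly_Mapping.keys (base_change u) = Poly_Mapping.keys u"
    by (auto simp: in_keys_iff Zero_fract_def eq_fract)
  have sum: "base_change (\<Sum>w\<in>W. g w) = (\<Sum>w\<in>W. base_change (g w))"
    if "finite W" for W :: "'b set" and g :: "'b \<Rightarrow> word \<Rightarrow>\<^sub>0 'a"
    using that
  proof induction
    case empty
    show ?case by (rule poly_mapping_eqI) (simp add: Zero_fract_def)
  qed (simp add: base_change_add)
  show ?thesis
    by (simp add: lin_ext_def keys sum base_change_scale)
qed

lemma base_change_stuffle_word: "base_change (stuffle_word u v) = stuffle_word u v"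
  by (induction u v rule: stuffle_word.induct)
    (simp_all add: base_change_add prepend_def base_change_lin_ext)

lemma stuffle_K_eq_stuffle: "stuffle_K = stuffle"
  by (simp add: stuffle_K_def stuffle_def[where 'k = "'a poly fract"] stuffle_single
      base_change_stuffle_word)

lemma base_change_stuffle: "base_change (stuffle u v) = stuffle_K (base_change u) (base_change v)"
  by (simp add: stuffle_K_eq_stuffle stuffle_def bilin_ext_def base_change_lin_ext
      base_change_stuffle_word)

end

theory Submission
  imports Defs
begin

text \<open>
  Truncating the sums at \<open>d\<^sub>1 < d\<close> gives finite sums for which the stuffle product formula is an
  induction on \<open>d\<close>; multiplicativity of \<open>Zstar\<close> follows by passing to the limit.

  Carlitz' power sums of exponent \<open>s \<le> q\<close> over the monic polynomials of degree \<open>d\<close> are the powers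
  \<open>\<ell>\<^sub>d\<^sup>-\<^sup>s\<close>: the logarithmic derivative of the product of all \<open>X - a\<close> is determined up to order \<open>q\<close>
  by two coefficients. Hence \<open>Li w = zeta_A w\<close> as soon as all letters of \<open>w\<close> are at most \<open>q\<close>.

  For the other words, put \<open>u\<^sub>d = \<ell>\<^sub>d\<^sup>-\<^sup>1\<close>. The identity
  \<open>u\<^sub>d\<^sup>q = \<ell>\<^sub>1 u\<^bsub>d+1\<^esub> (\<Sum>j\<le>d. u\<^sub>j ^ (q - 1))\<close> rewrites a letter \<open>q + b\<close> into
  a combination of words of the same weight which are longer, or of equal length and
  lexicographically larger. As there are only finitely many words of a given weight, iterating this
  ends in words with letters at most \<open>q\<close>.
\<close>

section \<open>Carlitz' power sums\<close>

lemma power_CARD_eq_same: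
  fixes c :: "'a::{field,finite}"
  shows "c ^ CARD('a) = c"
proof (cases "c = 0")
  case False
  \<comment> \<open>Multiplication by \<open>c\<close> permutes the nonzero elements; cancelling
    their product leaves \<open>c ^ (q - 1) = 1\<close>.\<close>
  have "(\<Prod>y\<in>UNIV-{0}. c * y) = (\<Prod>y\<in>UNIV-{0}. y)"
    by (rule prod.reindex_bij_witness[of _ "\<lambda>y. y / c" "\<lambda>y. c * y"]) (use False in auto)
  then have "c ^ (CARD('a) - 1) = 1"
    by (simp add: prod.distrib)
  then show ?thesis
    using power_Suc[of c "CARD('a) - 1"] by simp
qed (simp add: power_0_left)

text \<open>Translation by 1 permutes the field, so the sum of all elements does not change when
  \<open>q\<close> copies of 1 are added to it.\<close>

lemma of_nat_CARD_eq_0: "(of_nat CARD('a) :: 'a::{field,finite}) = 0"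
proof -
  have "(\<Sum>x\<in>UNIV. x + 1) = (\<Sum>x\<in>UNIV. x :: 'a)"
    by (rule sum.reindex_bij_witness[of _ "\<lambda>y. y - 1" "\<lambda>y. y + 1"]) auto
  then show ?thesis
    by (simp add: sum.distrib)
qed

lemma fls_const_power_CARD [simp]:
  "fls_const (c::'a::{field,finite}) ^ CARD('a) = fls_const c"
  by (simp add: power_CARD_eq_same flip: fls_const_power)

lemma fls_power_CARD_add:
  fixes x y :: "'a::{field,finite} fls"
  shows "(x + y) ^ CARD('a) = x ^ CARD('a) + y ^ CARD('a)"
proof (cases "y = 0")
  case False
  let ?q = "CARD('a)"
  let ?P = "[:y, 1:] ^ ?q" and ?R = "monom 1 ?q + [:y ^ ?q:]"
  have q: "?q > 0" by simp
  \<comment> \<open>As polynomials in \<open>x\<close>, both sides are monic of degree \<open>q\<close> and agree at the \<open>q\<close> multiples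
    of \<open>y\<close> by constants.\<close>
  have "?P = ?R"
  proof (rule poly_eqI_degree_lead_coeff[where n = ?q and A = "(\<lambda>c. fls_const c * y) ` UNIV"])
    have "coeff ?P ?q = 1"
      using lead_coeff_power[of "[:y, 1:]" ?q] by (simp add: degree_power_eq)
    then show "coeff ?P ?q = coeff ?R ?q"
      using q by (simp add: coeff_pCons split: nat.splits)
    have "inj (\<lambda>c. fls_const c * y)"
      using False by (auto intro!: injI simp: fls_const_nonzero fls_eq_iff)
    then show "?q \<le> card ((\<lambda>c. fls_const c * y) ` (UNIV :: 'a set))"
      by (simp add: card_image)
    show "degree ?P \<le> ?q"
      by (simp add: degree_power_eq)
    show "degree ?R \<le> ?q"
      by (intro degree_add_le) (simp_all add: degree_monom_le)
  next
    fix z assume "z \<in> (\<lambda>c. fls_const c * y) ` UNIV"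
    then obtain c where z: "z = fls_const c * y" by auto
    have "y + z = fls_const (c + 1) * y"
      by (simp add: z algebra_simps flip: fls_plus_const)
    then have "(y + z) ^ ?q = fls_const (c + 1) * y ^ ?q"
      by (simp add: power_mult_distrib del: fls_plus_const)
    then show "poly ?P z = poly ?R z"
      by (simp add: z poly_monom power_mult_distrib algebra_simps flip: fls_plus_const)
  qed
  then have "poly ?P x = poly ?R x" by simp
  then show ?thesis by (simp add: poly_monom add.commute)
qed simp

lemma fls_power_CARD_uminus:
  fixes x :: "'a::{field,finite} fls"
  shows "(- x) ^ CARD('a) = - (x ^ CARD('a))"
  using fls_power_CARD_add[of x "- x"] by (simp add: eq_neg_iff_add_eq_0 add.commute power_0_left)

lemma fls_power_CARD_diff:
  fixes x y :: "'a::{field,finite} fls"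
  shows "(x - y) ^ CARD('a) = x ^ CARD('a) - y ^ CARD('a)"
  using fls_power_CARD_add[of x "- y"] by (simp add: fls_power_CARD_uminus)

text \<open>
  In Carlitz' notation these are \<open>[d]\<close>, \<open>D\<^sub>d\<close> and \<open>e\<^sub>d\<close>: \<open>D\<^sub>d\<close> is the product of the monic
  polynomials of degree \<open>d\<close> and \<open>e\<^sub>d\<close> is the product of all \<open>X - a\<close> with \<open>deg a < d\<close>. Starting from
  his recursions, these product formulas become statements about roots.
\<close>

definition carlitz_bracket :: "nat \<Rightarrow> 'a::{field,finite} fls" where
  "carlitz_bracket d = fls_X_inv ^ (CARD('a) ^ d) - fls_X_inv"

fun carlitz_D :: "nat \<Rightarrow> 'a::{field,finite} fls" where
  "carlitz_D 0 = 1"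
| "carlitz_D (Suc d) = carlitz_bracket (Suc d) * carlitz_D d ^ CARD('a)"

fun carlitz_poly :: "nat \<Rightarrow> 'a::{field,finite} fls poly" where
  "carlitz_poly 0 = [:0, 1:]"
| "carlitz_poly (Suc d) =
     carlitz_poly d ^ CARD('a) - smult (carlitz_D d ^ (CARD('a) - 1)) (carlitz_poly d)"

lemma carlitz_bracket_Suc:
  "carlitz_bracket (Suc d) = (carlitz_bracket d :: 'a::{field,finite} fls) ^ CARD('a) + carlitz_bracket 1"
  by (simp add: carlitz_bracket_def fls_power_CARD_diff mult.commute flip: power_mult)

text \<open>Only \<open>q\<close>-th powers and scalar multiples enter the recursion; hence this
  additivity and the compatibility with constants in the next lemma.\<close>

lemma carlitz_poly_add:
  "poly (carlitz_poly d) (x + y) = poly (carlitz_poly d) x + poly (carlitz_poly d) (y :: 'a::{field,finite} fls)"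
  by (induction d) (simp_all add: fls_power_CARD_add algebra_simps)

lemma carlitz_poly_scale:
  "poly (carlitz_poly d) (fls_const c * x) = fls_const c * poly (carlitz_poly d) (x :: 'a::{field,finite} fls)"
  by (induction d) (simp_all add: power_mult_distrib algebra_simps)

text \<open>This relation passes from \<open>b\<close> to \<open>c + \<theta> b\<close> and so
  drives the induction on the degree in \<open>carlitz_poly_A\<close>. Its own induction applies the
  recursion of \<open>carlitz_poly\<close> both at \<open>x\<close> and at
  \<open>\<theta> x\<close>.\<close>

lemma carlitz_poly_theta:
  fixes x :: "'a::{field,finite} fls"
  shows "poly (carlitz_poly (Suc d)) (fls_X_inv * x) =
    fls_X_inv * poly (carlitz_poly (Suc d)) x + carlitz_bracket (Suc d) * poly (carlitz_poly d) x ^ CARD('a)"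
proof (induction d)
  case 0
  show ?case by (simp add: carlitz_bracket_def power_mult_distrib algebra_simps)
next
  case (Suc d)
  let ?q = "CARD('a)" and ?t = "fls_X_inv :: 'a fls"
  let ?b = "carlitz_bracket (Suc d) :: 'a fls" and ?D = "carlitz_D d :: 'a fls"
  define e where "e = poly (carlitz_poly d) x"
  define f where "f = poly (carlitz_poly (Suc d)) x"
  have q: "?q = Suc (?q - 1)" by simp
  have bq: "carlitz_bracket (Suc (Suc d)) = ?b ^ ?q + ?t ^ ?q - ?t"
    by (simp add: carlitz_bracket_Suc[of "Suc d"]) (simp add: carlitz_bracket_def)
  have f: "f = e ^ ?q - ?D ^ (?q - 1) * e"
    by (simp add: f_def e_def)
  have "f ^ ?q = (e ^ ?q) ^ ?q - (?D ^ (?q - 1)) ^ ?q * e ^ ?q"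
    by (simp add: f fls_power_CARD_diff power_mult_distrib)
  moreover have "carlitz_D (Suc d) ^ (?q - 1) * ?b = ?b ^ ?q * (?D ^ (?q - 1)) ^ ?q"
  proof -
    have "?b ^ ?q = ?b * ?b ^ (?q - 1)" by (metis q power_Suc)
    then show ?thesis by (simp add: power_mult_distrib mult_ac flip: power_mult)
  qed
  moreover have "poly (carlitz_poly (Suc (Suc d))) (?t * x) =
      (?t * f + ?b * e ^ ?q) ^ ?q - carlitz_D (Suc d) ^ (?q - 1) * (?t * f + ?b * e ^ ?q)"
    using Suc.IH unfolding carlitz_poly.simps(2)[of "Suc d"] f_def e_def by simp
  moreover have "\<dots> = ?t ^ ?q * f ^ ?q + ?b ^ ?q * (e ^ ?q) ^ ?q - carlitz_D (Suc d) ^ (?q - 1) * ?t * f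
      - carlitz_D (Suc d) ^ (?q - 1) * ?b * e ^ ?q"
    by (simp only: fls_power_CARD_add power_mult_distrib) (simp add: algebra_simps)
  moreover have "poly (carlitz_poly (Suc (Suc d))) x = f ^ ?q - carlitz_D (Suc d) ^ (?q - 1) * f"
    unfolding carlitz_poly.simps(2)[of "Suc d"] f_def by simp
  \<comment> \<open>A polynomial identity, used with \<open>u = ?t ^ ?q\<close>,
    \<open>F = f ^ ?q\<close>, \<open>B = ?b ^ ?q\<close>, \<open>g = (e ^ ?q) ^ ?q\<close>,
    \<open>r = e ^ ?q\<close>. The condition \<open>s * ?b = B * y\<close> is the relation between
    \<open>carlitz_D (Suc d)\<close> and \<open>carlitz_D d\<close> shown above.\<close>
  moreover have "u * F + B * g - s * ?t * f - s * ?b * r = ?t * (F - s * f) + (B + u - ?t) * F"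
    if "F = g - y * r" "s * ?b = B * y" for u F B g s r y :: "'a fls"
    unfolding that by (simp add: algebra_simps)
  ultimately show ?case
    unfolding bq f_def[symmetric] by simp
qed

text \<open>Write \<open>a = c + \<theta> b\<close>: linearity removes \<open>c\<close>, since
  \<open>e\<^sub>d\<close> with \<open>d > 0\<close> kills constants, and
  \<open>carlitz_poly_theta\<close> reduces the rest to \<open>b\<close>. In particular the monic
  polynomials of degree \<open>d\<close> are roots of \<open>e\<^sub>d - D\<^sub>d\<close>.\<close>

lemma carlitz_poly_A:
  fixes a :: "'a::{field,finite} poly"
  assumes "degree a \<le> d"
  shows "poly (carlitz_poly d) (A_to_Kinf a) = fls_const (coeff a d) * carlitz_D d"
  using assms
proof (induction d arbitrary: a)
  case 0
  then obtain c where "a = [:c:]" by (auto elim: degree_eq_zeroE)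
  then show ?case by (simp add: A_to_Kinf_pCons)
next
  case (Suc d)
  let ?q = "CARD('a)"
  \<comment> \<open>The value of \<open>e\<^sub>d\<close> at \<open>b\<close> is a constant multiple
    of \<open>D\<^sub>d\<close>, hence a root of
    \<open>X ^ q - D\<^sub>d ^ (q - 1) X\<close>.\<close>
  have van: "poly (carlitz_poly (Suc d)) (A_to_Kinf b) = 0" if "degree b \<le> d" for b :: "'a poly"
  proof -
    have "carlitz_D d ^ ?q = carlitz_D d ^ (?q - 1) * (carlitz_D d :: 'a fls)"
      by (metis power_minus_mult zero_less_card_finite)
    then show ?thesis by (simp add: Suc.IH[OF that] power_mult_distrib mult_ac)
  qed
  obtain c b where a: "a = pCons c b" by (cases a)
  with Suc.prems have b: "degree b \<le> d" by (cases "b = 0") auto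
  have "poly (carlitz_poly (Suc d)) (A_to_Kinf a) =
      poly (carlitz_poly (Suc d)) (fls_const c * 1) + poly (carlitz_poly (Suc d)) (fls_X_inv * A_to_Kinf b)"
    unfolding a A_to_Kinf_pCons carlitz_poly_add by simp
  also have "\<dots> = carlitz_bracket (Suc d) * poly (carlitz_poly d) (A_to_Kinf b) ^ ?q"
    unfolding carlitz_poly_scale carlitz_poly_theta van[OF b] using van[of 1] by simp
  also have "\<dots> = fls_const (coeff a (Suc d)) * carlitz_D (Suc d)"
    by (simp add: Suc.IH[OF b] a power_mult_distrib)
  finally show ?case .
qed

lemma degree_carlitz_poly:
  "degree (carlitz_poly d :: 'a::{field,finite} fls poly) = CARD('a) ^ d \<and>
   coeff (carlitz_poly d :: 'a fls poly) (CARD('a) ^ d) = 1"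
proof (induction d)
  case (Suc d)
  let ?q = "CARD('a)" and ?E = "carlitz_poly d :: 'a fls poly"
  let ?s = "smult (carlitz_D d ^ (?q - 1)) ?E"
  have deg: "degree (?E ^ ?q) = ?q ^ Suc d"
    using Suc by (subst degree_power_eq) auto
  have "degree ?s \<le> ?q ^ d"
    using Suc degree_smult_le[of "carlitz_D d ^ (?q - 1)" ?E] by simp
  also have "\<dots> < ?q ^ Suc d"
    using CARD_field_ge_2[where 'a='a] by simp
  finally have "degree (- ?s) < degree (?E ^ ?q)"
    unfolding deg by simp
  moreover have "carlitz_poly (Suc d) = ?E ^ ?q + (- ?s)" by simp
  ultimately have "degree (carlitz_poly (Suc d) :: 'a fls poly) = ?q ^ Suc d"
    and "lead_coeff (carlitz_poly (Suc d) :: 'a fls poly) = lead_coeff (?E ^ ?q)"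
    using deg degree_add_eq_left[of "- ?s" "?E ^ ?q"] lead_coeff_add_le[of "- ?s" "?E ^ ?q"]
    by (metis, metis add.commute)
  then show ?case using Suc lead_coeff_power[of ?E ?q] by simp
qed simp

lemma coeff_carlitz_poly_0: "coeff (carlitz_poly d) 0 = 0"
  by (induction d) (simp_all add: coeff_0_power power_0_left)

text \<open>Since \<open>X\<close> divides \<open>e\<^sub>d\<close>, its \<open>q\<close>-th power
  contributes nothing below order \<open>q\<close>.\<close>

lemma coeff_carlitz_poly_low:
  assumes "i < CARD('a)"
  shows "coeff (carlitz_poly (Suc d) :: 'a::{field,finite} fls poly) i =
     - (carlitz_D d ^ (CARD('a) - 1) * coeff (carlitz_poly d) i)"
proof -
  let ?q = "CARD('a)" and ?E = "carlitz_poly d :: 'a fls poly"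
  have "[:0, 1:] dvd ?E"
    using coeff_carlitz_poly_0[of d] by (simp add: poly_0_coeff_0 flip: poly_eq_0_iff_dvd[where c = 0, simplified])
  then have "[:0, 1:] ^ ?q dvd ?E ^ ?q" by (rule dvd_power_same)
  then obtain r where "?E ^ ?q = monom 1 ?q * r"
    by (auto simp: dvd_def monom_altdef)
  then have "coeff (?E ^ ?q) i = 0"
    using assms by (simp add: coeff_monom_mult)
  then show ?thesis by simp
qed

lemma coeff_carlitz_poly_eq_0:
  assumes "1 < i" "i < CARD('a)"
  shows "coeff (carlitz_poly d :: 'a::{field,finite} fls poly) i = 0"
proof (induction d)
  case 0
  show ?case using assms by (auto simp: coeff_pCons split: nat.splits)
next
  case (Suc d)
  then show ?case using coeff_carlitz_poly_low[OF assms(2)] by simp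
qed

section \<open>The products \<open>\<ell>\<^sub>d\<close> and the linear coefficients of the Carlitz
  polynomials\<close>

lemma ell_Suc:
  "A_to_Kinf (ell (Suc d) :: 'a::{field,finite} poly) = A_to_Kinf (ell d) * (- carlitz_bracket (Suc d))"
proof -
  have [simp]: "A_to_Kinf ([:0, 1:] ^ n) = (fls_X_inv ^ n :: 'a fls)" for n
    by (induction n) (simp_all add: A_to_Kinf_mult A_to_Kinf_theta del: mult_pCons_left)
  have "A_to_Kinf (p - r) + A_to_Kinf r = (A_to_Kinf p :: 'a fls)" for p r
    by (simp flip: A_to_Kinf_add)
  then have diff: "A_to_Kinf (p - r) = (A_to_Kinf p - A_to_Kinf r :: 'a fls)" for p r
    by (simp add: eq_diff_eq)
  show ?thesis
    by (simp add: ell_def A_to_Kinf_mult diff A_to_Kinf_theta carlitz_bracket_def del: power_Suc)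
qed

lemma ell_0 [simp]: "ell 0 = 1"
  by (simp add: ell_def)

lemma ell_nonzero: "ell d \<noteq> (0 :: 'a::{field,finite} poly)"
proof (induction d)
  case (Suc d)
  have "degree (ell (Suc d) :: 'a poly) \<noteq> 0"
    using degree_ell[of "Suc d", where 'a='a] by simp
  then show ?case by auto
qed simp

lemma carlitz_bracket_nonzero: "carlitz_bracket (Suc d) \<noteq> (0 :: 'a::{field,finite} fls)"
  using ell_Suc[of d, where 'a='a] ell_nonzero[of "Suc d", where 'a='a] by auto

lemma carlitz_D_nonzero: "carlitz_D d \<noteq> (0 :: 'a::{field,finite} fls)"
  by (induction d) (simp_all add: carlitz_bracket_nonzero)

text \<open>One step of the recursion multiplies the linear coefficient by
  \<open>- D\<^sub>d ^ (q - 1)\<close> and turns \<open>D\<^sub>d\<close> into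
  \<open>[d+1] D\<^sub>d ^ q\<close>. The quotient gains the factor \<open>- 1 / [d+1]\<close>,
  exactly as \<open>1 / \<ell>\<^sub>d\<close> does.\<close>

lemma coeff_carlitz_poly_1:
  "coeff (carlitz_poly d) 1 / carlitz_D d = (inverse (A_to_Kinf (ell d)) :: 'a::{field,finite} fls)"
proof (induction d)
  case (Suc d)
  let ?q = "CARD('a)" and ?D = "carlitz_D d :: 'a fls"
  have "coeff (carlitz_poly (Suc d) :: 'a fls poly) 1 = - (?D ^ (?q - 1) * coeff (carlitz_poly d) 1)"
    using CARD_field_ge_2[where 'a='a] by (intro coeff_carlitz_poly_low) simp
  moreover have "?D ^ ?q = ?D ^ (?q - 1) * ?D"
    by (metis power_minus_mult zero_less_card_finite)
  ultimately have "coeff (carlitz_poly (Suc d)) 1 / carlitz_D (Suc d) =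
      (coeff (carlitz_poly d) 1 / ?D) * inverse (- carlitz_bracket (Suc d))"
    using carlitz_D_nonzero[of d, where 'a='a] by (simp add: divide_simps)
  also have "\<dots> = inverse (A_to_Kinf (ell (Suc d)))"
    unfolding Suc ell_Suc by (simp add: mult.commute)
  finally show ?case .
qed simp

section \<open>Monic polynomials of degree \<open>d\<close> as roots\<close>

lemma card_monic:
  "card {a :: 'a::{field,finite} poly. lead_coeff a = 1 \<and> degree a = d} = CARD('a) ^ d"
proof (induction d)
  case 0
  have "{a :: 'a poly. lead_coeff a = 1 \<and> degree a = 0} = {1}"
    by (auto elim: degree_eq_zeroE)
  then show ?case by simp
next
  case (Suc d)
  let ?M = "\<lambda>d. {a :: 'a poly. lead_coeff a = 1 \<and> degree a = d}"
  have "bij_betw (\<lambda>(c, p). pCons c p) (UNIV \<times> ?M d) (?M (Suc d))"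
    unfolding bij_betw_def
  proof
    have "inj (\<lambda>(c, p :: 'a poly). pCons c p)" by (simp add: inj_def)
    then show "inj_on (\<lambda>(c, p). pCons c p) (UNIV \<times> ?M d)" by (rule inj_on_subset) simp
    show "(\<lambda>(c, p). pCons c p) ` (UNIV \<times> ?M d) = ?M (Suc d)"
    proof (intro equalityI subsetI)
      fix a assume a: "a \<in> ?M (Suc d)"
      obtain c p where "a = pCons c p" by (cases a)
      with a show "a \<in> (\<lambda>(c, p). pCons c p) ` (UNIV \<times> ?M d)"
        by (intro image_eqI[of _ _ "(c, p)"]) (auto split: if_splits)
    qed (auto split: if_splits)
  qed
  then show ?case
    using Suc by (simp flip: bij_betw_same_card add: card_cartesian_product)
qed

lemma finite_monic: "finite {a :: 'a::{field,finite} poly. lead_coeff a = 1 \<and> degree a = d}"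
  by (rule finite_subset[OF _ finite_degree_le[of d]]) auto

lemma inj_A_to_Kinf: "inj A_to_Kinf"
proof (rule injI)
  fix x y :: "'a poly" assume "A_to_Kinf x = A_to_Kinf y"
  then have "A_to_Kinf (x - y) = 0"
    using A_to_Kinf_add[of "x - y" y] by simp
  then show "x = y" by simp
qed

text \<open>Both sides are monic of degree \<open>q ^ d\<close> and vanish at the
  \<open>q ^ d\<close> monic polynomials of degree \<open>d\<close>.\<close>

lemma prod_monic_eq_carlitz_poly:
  "(\<Prod>z\<in>A_to_Kinf ` {a :: 'a::{field,finite} poly. lead_coeff a = 1 \<and> degree a = d}. [:- z, 1:]) =
     carlitz_poly d - [:carlitz_D d:]"
  (is "?P = ?R")
proof (rule poly_eqI_degree_lead_coeff)
  let ?A = "A_to_Kinf ` {a :: 'a poly. lead_coeff a = 1 \<and> degree a = d}"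
  have card: "card ?A = CARD('a) ^ d"
    by (simp add: card_image inj_on_subset[OF inj_A_to_Kinf] card_monic)
  then show "CARD('a) ^ d \<le> card ?A" by simp
  have fin: "finite ?A" by (intro finite_imageI finite_monic)
  have deg: "degree ?P = CARD('a) ^ d"
    by (subst degree_prod_eq_sum_degree) (simp_all add: card)
  then show "degree ?P \<le> CARD('a) ^ d" by simp
  show "degree ?R \<le> CARD('a) ^ d"
    using degree_carlitz_poly[of d, where 'a='a] by (intro degree_diff_le) simp_all
  have "lead_coeff ?P = 1" by (simp add: lead_coeff_prod)
  \<comment> \<open>Even for \<open>d = 0\<close> the index \<open>q ^ d\<close> is positive, so the
    constant leaves the leading coefficient alone.\<close>
  moreover have "coeff [:carlitz_D d :: 'a fls:] (CARD('a) ^ d) = 0"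
    by (rule coeff_eq_0) simp
  then have "coeff ?R (CARD('a) ^ d) = 1"
    using degree_carlitz_poly[of d, where 'a='a] by simp
  ultimately show "coeff ?P (CARD('a) ^ d) = coeff ?R (CARD('a) ^ d)"
    using deg by simp
  fix z assume z: "z \<in> ?A"
  then have "poly ?P z = 0" using fin by (auto simp: poly_prod)
  moreover have "poly ?R z = 0" using z by (auto simp: carlitz_poly_A)
  ultimately show "poly ?P z = poly ?R z" by simp
qed

section \<open>Power sums over the inverse roots of a polynomial\<close>

text \<open>The generating function \<open>G\<close> of the power sums satisfies
  \<open>G * P = - pderiv P\<close>. By \<open>low\<close> and \<open>top\<close>, comparing
  coefficients makes \<open>G\<close> a geometric progression with ratio
  \<open>- coeff P 1 / coeff P 0\<close> up to index \<open>n - 1\<close>.\<close>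

lemma power_sum_roots:
  fixes A :: "'b::field set"
  assumes fin: "finite A" and nz: "0 \<notin> A"
    and P: "P = (\<Prod>a\<in>A. [:- a, 1:])"
    and low: "\<And>i. 1 < i \<Longrightarrow> i < n \<Longrightarrow> coeff P i = 0"
    and top: "of_nat n * coeff P n = 0"
    and k: "k < n"
  shows "(\<Sum>a\<in>A. inverse a ^ Suc k) = (- coeff P 1 / coeff P 0) ^ Suc k"
proof -
  define G where "G = Abs_fps (\<lambda>k. \<Sum>a\<in>A. inverse a ^ Suc k)"
  \<comment> \<open>The series is the geometric expansion of \<open>1 / (a - X)\<close>.\<close>
  have geom: "Abs_fps (\<lambda>k. inverse a ^ Suc k) * fps_of_poly [:- a, 1:] = - 1" if "a \<noteq> 0" for a :: 'b
  proof (rule fps_ext)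
    fix m
    show "(Abs_fps (\<lambda>k. inverse a ^ Suc k) * fps_of_poly [:- a, 1:]) $ m = (- 1 :: 'b fps) $ m"
      using that by (cases m) (simp_all add: fps_of_poly_linear distrib_left)
  qed
  have "G = (\<Sum>a\<in>A. Abs_fps (\<lambda>k. inverse a ^ Suc k))"
    by (rule fps_ext) (simp add: G_def fps_sum_nth)
  then have "G * fps_of_poly P = (\<Sum>a\<in>A. Abs_fps (\<lambda>k. inverse a ^ Suc k) * fps_of_poly P)"
    by (simp add: sum_distrib_right)
  also have "\<dots> = (\<Sum>a\<in>A. - fps_of_poly (\<Prod>b\<in>A - {a}. [:- b, 1:]))"
  proof (rule sum.cong)
    fix a assume a: "a \<in> A"
    then have "P = [:- a, 1:] * (\<Prod>b\<in>A - {a}. [:- b, 1:])"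
      unfolding P by (rule prod.remove[OF fin])
    then have "Abs_fps (\<lambda>k. inverse a ^ Suc k) * fps_of_poly P =
        (Abs_fps (\<lambda>k. inverse a ^ Suc k) * fps_of_poly [:- a, 1:]) * fps_of_poly (\<Prod>b\<in>A - {a}. [:- b, 1:])"
      by (simp only: fps_of_poly_mult mult.assoc)
    also have "Abs_fps (\<lambda>k. inverse a ^ Suc k) * fps_of_poly [:- a, 1:] = - 1"
      using a nz by (intro geom) auto
    finally show "Abs_fps (\<lambda>k. inverse a ^ Suc k) * fps_of_poly P =
        - fps_of_poly (\<Prod>b\<in>A - {a}. [:- b, 1:])"
      by (simp only: mult_minus1)
  qed simp
  also have "\<dots> = - fps_of_poly (pderiv P)"
    by (simp add: P pderiv_prod pderiv_pCons fps_of_poly_sum sum_negf)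
  finally have eq: "G * fps_of_poly P = - fps_of_poly (pderiv P)" .
  have P0: "coeff P 0 \<noteq> 0"
    using fin nz by (auto simp: P poly_prod simp flip: poly_0_coeff_0)
  have "G $ k = (- coeff P 1 / coeff P 0) ^ Suc k"
    using k
  proof (induction k)
    case 0
    have "(G * fps_of_poly P) $ 0 = - coeff P 1"
      by (simp add: eq coeff_pderiv)
    then have "G $ 0 * coeff P 0 = - coeff P 1" by simp
    then show ?case using P0 by (simp add: field_simps)
  next
    case (Suc k)
    have "(G * fps_of_poly P) $ Suc k = - (of_nat (Suc (Suc k)) * coeff P (Suc (Suc k)))"
      by (simp add: eq coeff_pderiv)
    \<comment> \<open>If \<open>k + 2 < n\<close> the coefficient vanishes by \<open>low\<close>; if
      \<open>k + 2 = n\<close> the product vanishes by \<open>top\<close>.\<close>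
    also have "\<dots> = 0"
      using low[of "Suc (Suc k)"] top Suc.prems by (cases "Suc (Suc k) = n") auto
    \<comment> \<open>In the convolution the coefficients of \<open>P\<close> of index 2 up to
      \<open>Suc k\<close> vanish by \<open>low\<close>.\<close>
    also have "(G * fps_of_poly P) $ Suc k = (\<Sum>i\<in>{k, Suc k}. G $ i * coeff P (Suc k - i))"
      unfolding fps_mult_nth fps_of_poly_nth
      by (rule sum.mono_neutral_right) (use low Suc.prems in auto)
    finally have "G $ Suc k * coeff P 0 = - coeff P 1 * G $ k"
      by (simp add: algebra_simps eq_neg_iff_add_eq_0)
    then have "G $ Suc k = (- coeff P 1 / coeff P 0) * G $ k"
      using P0 by (simp add: field_simps)
    then show ?case using Suc by simp
  qed
  then show ?thesis by (simp add: G_def)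
qed

text \<open>Apply \<open>power_sum_roots\<close> with \<open>n = q\<close> to
  \<open>e\<^sub>d - D\<^sub>d\<close>; the ratio there is \<open>1 / \<ell>\<^sub>d\<close> by
  \<open>coeff_carlitz_poly_1\<close>. The bound \<open>k < n\<close> becomes
  \<open>s \<le> q\<close>.\<close>

lemma power_sum_monic:
  assumes "0 < s" "s \<le> CARD('a)"
  shows "(\<Sum>a | lead_coeff a = 1 \<and> degree a = d. inverse (A_to_Kinf (a :: 'a::{field,finite} poly) ^ s)) =
    inverse (A_to_Kinf (ell d)) ^ s"
proof -
  let ?M = "{a :: 'a poly. lead_coeff a = 1 \<and> degree a = d}"
  let ?P = "carlitz_poly d - [:carlitz_D d:] :: 'a fls poly"
  obtain k where s: "s = Suc k" using assms(1) by (cases s) auto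
  have c: "coeff ?P i = coeff (carlitz_poly d) i" if "i > 0" for i
    using that by (simp add: coeff_pCons split: nat.splits)
  have "(\<Sum>z\<in>A_to_Kinf ` ?M. inverse z ^ Suc k) = (- coeff ?P 1 / coeff ?P 0) ^ Suc k"
  proof (rule power_sum_roots)
    show "?P = (\<Prod>z\<in>A_to_Kinf ` ?M. [:- z, 1:])" by (rule prod_monic_eq_carlitz_poly[symmetric])
    show "coeff ?P i = 0" if "1 < i" "i < CARD('a)" for i
      using that by (simp only: c coeff_carlitz_poly_eq_0)
    \<comment> \<open>The coefficient may be nonzero (it is 1 for \<open>d = 1\<close>), but the
      factor \<open>q\<close> is 0 in the field.\<close>
    show "of_nat CARD('a) * coeff ?P CARD('a) = 0"
      by (simp add: fls_of_nat of_nat_CARD_eq_0)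
    show "k < CARD('a)" using assms s by simp
    show "0 \<notin> A_to_Kinf ` ?M" by auto
  qed (intro finite_imageI finite_monic)
  moreover have "- coeff ?P 1 / coeff ?P 0 = inverse (A_to_Kinf (ell d))"
    using c[of 1] by (simp add: coeff_carlitz_poly_0 flip: coeff_carlitz_poly_1)
  ultimately have "(\<Sum>z\<in>A_to_Kinf ` ?M. inverse z ^ s) = inverse (A_to_Kinf (ell d)) ^ s"
    by (simp only: s)
  then show ?thesis
    by (simp add: sum.reindex inj_on_subset[OF inj_A_to_Kinf] power_inverse)
qed

section \<open>Limits of Laurent series\<close>

text \<open>The balls of radius \<open>inverse (2 ^ N)\<close> suffice, and
  \<open>dist_fls_less_iff\<close> describes them by coefficients.\<close>

lemma fls_tendsto_iff:
  fixes f :: "'b \<Rightarrow> 'a::ab_group_add fls"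
  shows "(f \<longlongrightarrow> l) F \<longleftrightarrow> (\<forall>N::nat. \<forall>\<^sub>F x in F. \<forall>k \<le> int N. f x $$ k = l $$ k)"
proof
  assume "(f \<longlongrightarrow> l) F"
  then show "\<forall>N::nat. \<forall>\<^sub>F x in F. \<forall>k \<le> int N. f x $$ k = l $$ k"
    unfolding tendsto_iff dist_fls_less_iff[symmetric] by simp
next
  assume *: "\<forall>N::nat. \<forall>\<^sub>F x in F. \<forall>k \<le> int N. f x $$ k = l $$ k"
  show "(f \<longlongrightarrow> l) F"
    unfolding tendsto_iff
  proof (intro allI impI)
    fix e :: real assume "e > 0"
    then obtain N :: nat where N: "inverse (2 ^ N) < e" by (rule ex_inverse_power2_less)
    from * have "\<forall>\<^sub>F x in F. dist (f x) l < inverse (2 ^ N)"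
      by (simp add: dist_fls_less_iff)
    then show "\<forall>\<^sub>F x in F. dist (f x) l < e"
      by eventually_elim (use N in linarith)
  qed
qed

lemma fls_tendsto_add:
  fixes f g :: "'b \<Rightarrow> 'a::ab_group_add fls"
  assumes "(f \<longlongrightarrow> l) F" "(g \<longlongrightarrow> m) F"
  shows "((\<lambda>x. f x + g x) \<longlongrightarrow> l + m) F"
  unfolding fls_tendsto_iff
proof
  fix N :: nat
  have "\<forall>\<^sub>F x in F. \<forall>k \<le> int N. f x $$ k = l $$ k" "\<forall>\<^sub>F x in F. \<forall>k \<le> int N. g x $$ k = m $$ k"
    using assms unfolding fls_tendsto_iff by blast+
  then show "\<forall>\<^sub>F x in F. \<forall>k \<le> int N. (f x + g x) $$ k = (l + m) $$ k"
    by eventually_elim simp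
qed

lemma fls_times_nth_eq_0:
  fixes f g :: "'a::field fls"
  assumes "\<And>k. k < m \<Longrightarrow> f $$ k = 0" "\<And>k. k < n \<Longrightarrow> g $$ k = 0" "k < m + n"
  shows "(f * g) $$ k = 0"
proof (cases "f = 0 \<or> g = 0")
  case False
  then have "m \<le> fls_subdegree f" "n \<le> fls_subdegree g"
    using assms(1,2) by (auto intro: fls_subdegree_geI)
  then show ?thesis
    using False assms(3) by (intro fls_eq0_below_subdegree) simp
qed auto

lemma fls_tendsto_mult:
  fixes f g :: "'b \<Rightarrow> 'a::field fls"
  assumes "(f \<longlongrightarrow> l) F" "(g \<longlongrightarrow> m) F"
  shows "((\<lambda>x. f x * g x) \<longlongrightarrow> l * m) F"
  unfolding fls_tendsto_iff
proof
  fix N :: nat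
  \<comment> \<open>All orders are at least \<open>s\<close>: since
    \<open>s \<le> 0 \<le> M\<close>, agreement up to \<open>M\<close> makes \<open>g x\<close>
    vanish below \<open>s\<close> as \<open>m\<close> does. A factor vanishing up to
    \<open>M\<close> times one vanishing below \<open>s\<close> vanishes up to
    \<open>M + s = N\<close>.\<close>
  define s where "s = min 0 (min (fls_subdegree l) (fls_subdegree m))"
  define M where "M = nat (int N - s)"
  have M: "int M = int N - s" "s \<le> 0" "s \<le> fls_subdegree l" "s \<le> fls_subdegree m"
    by (simp_all add: M_def s_def)
  have "\<forall>\<^sub>F x in F. \<forall>k \<le> int M. f x $$ k = l $$ k" "\<forall>\<^sub>F x in F. \<forall>k \<le> int M. g x $$ k = m $$ k"
    using assms unfolding fls_tendsto_iff by blast+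
  then show "\<forall>\<^sub>F x in F. \<forall>k \<le> int N. (f x * g x) $$ k = (l * m) $$ k"
  proof eventually_elim
    case (elim x)
    show ?case
    proof (intro allI impI)
      fix k assume k: "k \<le> int N"
      have l0: "l $$ i = 0" and g0: "g x $$ i = 0" if "i < s" for i
        using that M elim by simp_all
      have "((f x - l) * g x) $$ k = 0"
        by (rule fls_times_nth_eq_0[of "int M + 1" _ s]) (use elim g0 k M in auto)
      moreover have "(l * (g x - m)) $$ k = 0"
        by (rule fls_times_nth_eq_0[of s _ "int M + 1"]) (use elim l0 k M in auto)
      moreover have "f x * g x = l * m + ((f x - l) * g x + l * (g x - m))"
        by (simp add: algebra_simps)
      ultimately show "(f x * g x) $$ k = (l * m) $$ k"
        by (metis add.right_neutral fls_plus_nth)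
    qed
  qed
qed

lemma fls_tendsto_sum:
  fixes f :: "'i \<Rightarrow> 'b \<Rightarrow> 'a::ab_group_add fls"
  assumes "\<And>i. i \<in> I \<Longrightarrow> (f i \<longlongrightarrow> l i) F"
  shows "((\<lambda>x. \<Sum>i\<in>I. f i x) \<longlongrightarrow> (\<Sum>i\<in>I. l i)) F"
  using assms by (induction I rule: infinite_finite_induct) (auto intro: fls_tendsto_add)

section \<open>Truncated sums\<close>

text \<open>The nested sum over \<open>d > d\<^sub>1 > d\<^sub>2 > ...\<close>. The parameter
  \<open>g\<close> allows powers of \<open>1 / \<ell>\<^sub>e\<close> as well as power sums over the
  monic polynomials of degree \<open>e\<close>.\<close>

fun trunc_sum :: "(nat \<Rightarrow> pnat \<Rightarrow> 'b::comm_ring_1) \<Rightarrow> word \<Rightarrow> nat \<Rightarrow> 'b" where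
  "trunc_sum g [] d = 1"
| "trunc_sum g (a # s) d = (\<Sum>e<d. g e a * trunc_sum g s e)"

lemma trunc_sum_cong:
  assumes "\<And>e a. a \<in> set s \<Longrightarrow> g e a = h e a"
  shows "trunc_sum g s d = trunc_sum h s d"
  using assms by (induction s arbitrary: d) simp_all

text \<open>Covers both index sets: monic polynomials with their degree, and natural numbers with
  the identity as \<open>deg\<close>.\<close>

definition decr_tuples :: "('b \<Rightarrow> bool) \<Rightarrow> ('b \<Rightarrow> nat) \<Rightarrow> nat \<Rightarrow> 'b list set" where
  "decr_tuples P deg n = {as. length as = n \<and> (\<forall>a\<in>set as. P a) \<and> sorted_wrt (\<lambda>a b. deg a > deg b) as}"

definition decr_tuples_below :: "('b \<Rightarrow> bool) \<Rightarrow> ('b \<Rightarrow> nat) \<Rightarrow> nat \<Rightarrow> nat \<Rightarrow> 'b list set" where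
  "decr_tuples_below P deg n d = {as \<in> decr_tuples P deg n. \<forall>a\<in>set as. deg a < d}"

lemma decr_tuples_below_0: "decr_tuples_below P deg 0 d = {[]}"
  by (auto simp: decr_tuples_below_def decr_tuples_def)

lemma decr_tuples_below_Suc:
  "decr_tuples_below P deg (Suc n) d =
     (\<lambda>(a, as). a # as) ` (SIGMA a:{a. P a \<and> deg a < d}. decr_tuples_below P deg n (deg a))"
proof (intro equalityI subsetI)
  fix as assume as: "as \<in> decr_tuples_below P deg (Suc n) d"
  then obtain b bs where "as = b # bs"
    by (auto simp: decr_tuples_below_def decr_tuples_def length_Suc_conv)
  with as show "as \<in> (\<lambda>(a, as). a # as) ` (SIGMA a:{a. P a \<and> deg a < d}. decr_tuples_below P deg n (deg a))"
    by (intro image_eqI[of _ _ "(b, bs)"]) (auto simp: decr_tuples_below_def decr_tuples_def)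
qed (fastforce simp: decr_tuples_below_def decr_tuples_def)

lemma finite_deg_less:
  assumes "\<And>e. finite {a. P a \<and> deg a = (e::nat)}"
  shows "finite {a. P a \<and> deg a < d}"
proof -
  have "{a. P a \<and> deg a < d} = (\<Union>e<d. {a. P a \<and> deg a = e})" by auto
  then show ?thesis using assms by simp
qed

lemma finite_decr_tuples_below:
  assumes "\<And>e. finite {a. P a \<and> deg a = e}"
  shows "finite (decr_tuples_below P deg n d)"
proof (induction n arbitrary: d)
  case 0
  show ?case by (simp add: decr_tuples_below_0)
next
  case (Suc n)
  show ?case
    unfolding decr_tuples_below_Suc
    by (intro finite_imageI finite_SigmaI Suc finite_deg_less assms)
qed

lemma sum_decr_tuples_below:
  fixes f :: "'b \<Rightarrow> pnat \<Rightarrow> 'c::comm_ring_1"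
  assumes fin: "\<And>e. finite {a. P a \<and> deg a = e}"
  shows "(\<Sum>as\<in>decr_tuples_below P deg (length s) d. \<Prod>i<length s. f (as ! i) (s ! i)) =
    trunc_sum (\<lambda>e k. \<Sum>a | P a \<and> deg a = e. f a k) s d"
proof (induction s arbitrary: d)
  case Nil
  show ?case by (simp add: decr_tuples_below_0)
next
  case (Cons k s)
  let ?T = "trunc_sum (\<lambda>e k. \<Sum>a | P a \<and> deg a = e. f a k) s"
  have inj: "inj_on (\<lambda>(a, as). a # as) X" for X :: "('b \<times> 'b list) set"
    by (auto simp: inj_on_def)
  have "(\<Sum>as\<in>decr_tuples_below P deg (length (k # s)) d. \<Prod>i<length (k # s). f (as ! i) ((k # s) ! i)) =
      (\<Sum>(a, as)\<in>(SIGMA a:{a. P a \<and> deg a < d}. decr_tuples_below P deg (length s) (deg a)).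
        f a k * (\<Prod>i<length s. f (as ! i) (s ! i)))"
    unfolding length_Cons decr_tuples_below_Suc sum.reindex[OF inj]
    by (simp add: prod.lessThan_Suc_shift case_prod_beta del: prod.lessThan_Suc)
  also have "\<dots> = (\<Sum>a | P a \<and> deg a < d. f a k * ?T (deg a))"
    by (subst sum.Sigma[symmetric])
      (simp_all add: finite_deg_less[OF fin] finite_decr_tuples_below[OF fin] Cons flip: sum_distrib_left)
  also have "{a. P a \<and> deg a < d} = (\<Union>e<d. {a. P a \<and> deg a = e})" by auto
  also have "(\<Sum>a\<in>\<dots>. f a k * ?T (deg a)) = (\<Sum>e<d. \<Sum>a | P a \<and> deg a = e. f a k * ?T (deg a))"
    by (rule sum.UNION_disjoint) (use fin in auto)
  finally show ?case by (simp add: sum_distrib_right)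
qed

text \<open>The sets \<open>decr_tuples_below\<close> exhaust the index set: every finite set of
  tuples lies in one of them and in all later ones.\<close>

lemma trunc_sum_tendsto_infsum:
  fixes f :: "'b \<Rightarrow> pnat \<Rightarrow> 'a::field fls"
  assumes fin: "\<And>e. finite {a. P a \<and> deg a = e}"
    and sm: "(\<lambda>as. \<Prod>i<length s. f (as ! i) (s ! i)) summable_on decr_tuples P deg (length s)"
  shows "trunc_sum (\<lambda>e k. \<Sum>a | P a \<and> deg a = e. f a k) s
    \<longlonglongrightarrow> (\<Sum>\<^sub>\<infinity>as\<in>decr_tuples P deg (length s). \<Prod>i<length s. f (as ! i) (s ! i))"
proof -
  let ?X = "decr_tuples P deg (length s)" and ?Y = "decr_tuples_below P deg (length s)"
  let ?f = "\<lambda>as. \<Prod>i<length s. f (as ! i) (s ! i)"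
  have "filterlim ?Y (finite_subsets_at_top ?X) sequentially"
    unfolding filterlim_finite_subsets_at_top
  proof (intro allI impI)
    fix Z assume Z: "finite Z \<and> Z \<subseteq> ?X"
    define M where "M = Max (insert 0 (deg ` (\<Union>as\<in>Z. set as)))"
    have "deg a \<le> M" if "as \<in> Z" "a \<in> set as" for as a
      using that Z unfolding M_def by (intro Max_ge) auto
    then have "Z \<subseteq> ?Y d" if "d > M" for d
      using that Z unfolding decr_tuples_below_def by fastforce
    then show "\<forall>\<^sub>F d in sequentially. finite (?Y d) \<and> Z \<subseteq> ?Y d \<and> ?Y d \<subseteq> ?X"
      using finite_decr_tuples_below[OF fin] unfolding eventually_sequentially
      by (intro exI[of _ "Suc M"]) (auto simp: decr_tuples_below_def)
  qed
  moreover have "(sum ?f \<longlongrightarrow> infsum ?f ?X) (finite_subsets_at_top ?X)"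
    using has_sum_infsum[OF sm] by (simp add: has_sum_def)
  ultimately have "(\<lambda>d. sum ?f (?Y d)) \<longlonglongrightarrow> infsum ?f ?X"
    by (rule filterlim_compose[rotated])
  then show ?thesis by (simp add: sum_decr_tuples_below[OF fin])
qed

definition Li_trunc :: "word \<Rightarrow> nat \<Rightarrow> 'a::{field,finite} fls" where
  "Li_trunc = trunc_sum (\<lambda>e k. inverse (A_to_Kinf (ell e)) ^ nat_of_pnat k)"

lemma Li_trunc_tendsto: "Li_trunc s \<longlonglongrightarrow> (Li s :: 'a::{field,finite} fls)"
proof -
  have X: "{ds :: nat list. length ds = length s \<and> sorted_wrt (>) ds} = decr_tuples (\<lambda>_. True) (\<lambda>d. d) (length s)"
    by (simp add: decr_tuples_def)
  show ?thesis
    using trunc_sum_tendsto_infsum[where P = "\<lambda>_. True" and deg = "\<lambda>d. d" and s = s and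
        f = "\<lambda>d k. inverse (A_to_Kinf (ell d :: 'a poly) ^ nat_of_pnat k)"]
      Li_summable[of s, where 'a='a]
    by (simp add: X Li_def Li_trunc_def power_inverse)
qed

text \<open>By \<open>power_sum_monic\<close> the truncated sums agree for every bound, hence so do
  their limits.\<close>

lemma zeta_A_eq_Li:
  assumes "\<forall>k\<in>set s. nat_of_pnat k \<le> CARD('a)"
  shows "zeta_A s = (Li s :: 'a::{field,finite} fls)"
proof -
  let ?f = "\<lambda>(a :: 'a poly) k. inverse (A_to_Kinf a ^ nat_of_pnat k)"
  have X: "{as :: 'a poly list. length as = length s \<and> (\<forall>a\<in>set as. lead_coeff a = 1) \<and>
      sorted_wrt (\<lambda>a b. degree a > degree b) as} = decr_tuples (\<lambda>a. lead_coeff a = 1) degree (length s)"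
    by (simp add: decr_tuples_def)
  have "trunc_sum (\<lambda>e k. \<Sum>a | lead_coeff a = 1 \<and> degree a = e. ?f a k) s = Li_trunc s"
    unfolding Li_trunc_def using assms
    by (intro ext trunc_sum_cong power_sum_monic) (simp_all add: nat_of_pnat_pos)
  moreover have "trunc_sum (\<lambda>e k. \<Sum>a | lead_coeff a = 1 \<and> degree a = e. ?f a k) s \<longlonglongrightarrow> zeta_A s"
    unfolding zeta_A_def X
    by (rule trunc_sum_tendsto_infsum) (use finite_monic zeta_A_summable[of s, where 'a='a] X in simp_all)
  ultimately show ?thesis
    using Li_trunc_tendsto[of s, where 'a='a] LIMSEQ_unique by auto
qed

section \<open>The stuffle product formula\<close>

lemma linear_to_KinfI:
  assumes "\<And>u v. g (u + v) = g u + g v" "\<And>c u. g (pm_scale c u) = Kinf_scale c (g u)"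
  shows "Vector_Spaces.linear pm_scale Kinf_scale g"
  by unfold_locales (rule assms)+

lemma Li_trunc_Nil [simp]: "Li_trunc [] d = 1"
  by (simp add: Li_trunc_def)

lemma Li_trunc_Cons:
  "Li_trunc (a # s) d = (\<Sum>e<d. inverse (A_to_Kinf (ell e)) ^ nat_of_pnat a * Li_trunc s e)"
  by (simp add: Li_trunc_def)

definition Zstar_trunc :: "nat \<Rightarrow> (word \<Rightarrow>\<^sub>0 'a::{field,finite} poly fract) \<Rightarrow> 'a fls" where
  "Zstar_trunc d = lin_ext Kinf_scale (\<lambda>w. Li_trunc w d)"

lemma Zstar_trunc_add: "Zstar_trunc d (u + v) = Zstar_trunc d u + Zstar_trunc d v"
  by (simp add: Zstar_trunc_def lin_ext_add Kinf.vector_space_axioms)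

lemma Zstar_trunc_scale: "Zstar_trunc d (pm_scale c u) = Kinf_scale c (Zstar_trunc d u)"
  by (simp add: Zstar_trunc_def lin_ext_scale Kinf.vector_space_axioms)

lemma Zstar_trunc_diff: "Zstar_trunc d (u - v) = Zstar_trunc d u - Zstar_trunc d v"
  using Zstar_trunc_add[of d "u - v" v] by simp

lemma Zstar_trunc_single [simp]: "Zstar_trunc d (Poly_Mapping.single w 1) = Li_trunc w d"
  by (simp add: Zstar_trunc_def Kinf.vector_space_axioms)

lemma Zstar_trunc_prepend:
  "Zstar_trunc d (prepend a u) =
     (\<Sum>e<d. inverse (A_to_Kinf (ell e)) ^ nat_of_pnat a * Zstar_trunc e (u :: word \<Rightarrow>\<^sub>0 'a::{field,finite} poly fract))"
proof (rule linear_eqI[where u = u])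
  show "Vector_Spaces.linear pm_scale Kinf_scale (\<lambda>u :: word \<Rightarrow>\<^sub>0 'a poly fract. Zstar_trunc d (prepend a u))"
    by (rule linear_to_KinfI) (simp_all add: Zstar_trunc_add Zstar_trunc_scale prepend_add prepend_scale)
  show "Vector_Spaces.linear pm_scale Kinf_scale (\<lambda>u :: word \<Rightarrow>\<^sub>0 'a poly fract.
      \<Sum>e<d. inverse (A_to_Kinf (ell e)) ^ nat_of_pnat a * Zstar_trunc e u)"
    by (rule linear_to_KinfI)
      (simp_all add: Zstar_trunc_add Zstar_trunc_scale Kinf_scale_def sum_distrib_left algebra_simps
        flip: sum.distrib)
qed (simp add: prepend_single Li_trunc_Cons)

text \<open>Inside the induction on the words runs one on \<open>d\<close>. Raising \<open>d\<close>
  by one adds a last term to each factor; expanding the product gives three new terms, which match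
  the three terms of the stuffle recursion.\<close>

lemma Zstar_trunc_stuffle_word:
  "Zstar_trunc d (stuffle_word u v) = (Li_trunc u d * Li_trunc v d :: 'a::{field,finite} fls)"
proof (induction u v arbitrary: d rule: stuffle_word.induct)
  case (3 a u b v)
  show ?case
  proof (induction d)
    case 0
    show ?case by (simp add: Zstar_trunc_add Zstar_trunc_prepend Li_trunc_Cons)
  next
    case (Suc d)
    define x where "x = inverse (A_to_Kinf (ell d :: 'a poly)) ^ nat_of_pnat a"
    define y where "y = inverse (A_to_Kinf (ell d :: 'a poly)) ^ nat_of_pnat b"
    have xy: "inverse (A_to_Kinf (ell d :: 'a poly)) ^ nat_of_pnat (a + b) = x * y"
      by (simp add: x_def y_def plus_pnat.rep_eq power_add)
    have L: "Li_trunc (a # u) (Suc d) = Li_trunc (a # u) d + x * Li_trunc u d"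
      "Li_trunc (b # v) (Suc d) = Li_trunc (b # v) d + y * Li_trunc v d"
      by (simp_all add: Li_trunc_Cons x_def y_def)
    have "Zstar_trunc (Suc d) (stuffle_word (a # u) (b # v)) =
        Zstar_trunc d (stuffle_word (a # u) (b # v)) +
        (x * (Li_trunc u d * Li_trunc (b # v) d) + y * (Li_trunc (a # u) d * Li_trunc v d)
          + x * y * (Li_trunc u d * Li_trunc v d))"
      unfolding stuffle_word.simps(3) Zstar_trunc_add Zstar_trunc_prepend
      by (simp add: 3 xy flip: x_def y_def)
    also have "\<dots> = Li_trunc (a # u) (Suc d) * Li_trunc (b # v) (Suc d)"
      unfolding Suc L by (simp add: algebra_simps)
    finally show ?case .
  qed
qed simp_all

lemma Zstar_trunc_tendsto: "(\<lambda>d. Zstar_trunc d u) \<longlonglongrightarrow> Zstar u"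
  unfolding Zstar_trunc_def Zstar_def lin_ext_def Kinf_scale_def
  by (intro fls_tendsto_sum fls_tendsto_mult tendsto_const Li_trunc_tendsto)

lemma Zstar_add: "Zstar (u + v) = Zstar u + Zstar v"
  by (simp add: Zstar_def lin_ext_add Kinf.vector_space_axioms)

lemma Zstar_scale: "Zstar (pm_scale c u) = Kinf_scale c (Zstar u)"
  by (simp add: Zstar_def lin_ext_scale Kinf.vector_space_axioms)

lemma linear_Zstar: "Vector_Spaces.linear pm_scale Kinf_scale Zstar"
  unfolding Zstar_def by (rule linear_lin_ext[OF Kinf.vector_space_axioms])

lemma Zstar_single [simp]: "Zstar (Poly_Mapping.single w 1) = Li w"
  by (simp add: Zstar_def Kinf.vector_space_axioms)

text \<open>By bilinearity two words suffice; for them the truncated identity passes to the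
  limit.\<close>

lemma Zstar_stuffle:
  fixes u v :: "word \<Rightarrow>\<^sub>0 'a::{field,finite} poly fract"
  shows "Zstar (stuffle u v) = Zstar u * Zstar v"
proof (rule linear_eqI[where u = u])
  fix x
  let ?x = "Poly_Mapping.single x 1 :: word \<Rightarrow>\<^sub>0 'a poly fract"
  show "Zstar (stuffle ?x v) = Zstar ?x * Zstar v"
  proof (rule linear_eqI[where u = v])
    fix y
    have "(\<lambda>d. Li_trunc x d * Li_trunc y d) \<longlonglongrightarrow> Zstar (stuffle_word x y :: word \<Rightarrow>\<^sub>0 'a poly fract)"
      using Zstar_trunc_tendsto[of "stuffle_word x y"] by (simp add: Zstar_trunc_stuffle_word)
    moreover have "(\<lambda>d. Li_trunc x d * Li_trunc y d) \<longlonglongrightarrow> (Li x * Li y :: 'a fls)"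
      by (intro fls_tendsto_mult Li_trunc_tendsto)
    ultimately show "Zstar (stuffle ?x (Poly_Mapping.single y 1)) = Zstar ?x * Zstar (Poly_Mapping.single y 1)"
      by (simp add: stuffle_single LIMSEQ_unique)
  qed (rule linear_to_KinfI; simp add: stuffle_bilinear Zstar_add Zstar_scale Kinf_scale_def algebra_simps)+
qed (rule linear_to_KinfI; simp add: stuffle_bilinear Zstar_add Zstar_scale Kinf_scale_def algebra_simps)+

section \<open>Lowering the letters\<close>

lemma nat_of_pnat_CARD_minus_1: "nat_of_pnat (pnat_of_nat (CARD('a::{field,finite}) - 1)) = CARD('a) - 1"
  using CARD_field_ge_2[where 'a='a] by (simp add: pnat_of_nat_inverse)

lemma nat_of_pnat_CARD: "nat_of_pnat (pnat_of_nat CARD('a::finite)) = CARD('a)"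
  by (simp add: pnat_of_nat_inverse)

lemma nat_of_pnat_1: "nat_of_pnat (pnat_of_nat 1) = 1"
  by (simp add: pnat_of_nat_inverse)

text \<open>A telescoping closed form for the sum of \<open>\<ell>\<^sub>j ^ - (q - 1)\<close> over
  \<open>j \<le> d\<close>, resting on \<open>[d+2] = [d+1] ^ q + [1]\<close> and
  \<open>[1] = - \<ell>\<^sub>1\<close>.\<close>

lemma Li_trunc_CARD_minus_1:
  "Li_trunc [pnat_of_nat (CARD('a) - 1)] (Suc d) =
     (A_to_Kinf (ell (Suc d)) / (A_to_Kinf (ell 1) * A_to_Kinf (ell d) ^ CARD('a)) :: 'a::{field,finite} fls)"
proof (induction d)
  case 0
  have "A_to_Kinf (ell 1 :: 'a poly) \<noteq> 0" by (simp add: ell_nonzero)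
  then show ?case by (simp add: Li_trunc_Cons)
next
  case (Suc d)
  let ?q = "CARD('a)"
  define a b l where "a = A_to_Kinf (ell d :: 'a poly)"
    and "b = A_to_Kinf (ell (Suc d) :: 'a poly)" and "l = A_to_Kinf (ell 1 :: 'a poly)"
  define B where "B = (carlitz_bracket (Suc d) :: 'a fls)"
  have nz: "a \<noteq> 0" "b \<noteq> 0" "l \<noteq> 0" "B \<noteq> 0"
    by (simp_all add: a_def b_def l_def B_def ell_nonzero carlitz_bracket_nonzero)
  have b: "b = a * (- B)" unfolding a_def b_def B_def by (rule ell_Suc)
  then have bq: "b ^ ?q = - (a ^ ?q * B ^ ?q)"
    by (simp add: fls_power_CARD_uminus power_mult_distrib)
  have l: "carlitz_bracket 1 = - l"
    using ell_Suc[of 0, where 'a='a] by (simp add: l_def)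
  have c: "A_to_Kinf (ell (Suc (Suc d)) :: 'a poly) = b * (l - B ^ ?q)"
    unfolding ell_Suc[of "Suc d"] carlitz_bracket_Suc[of "Suc d"] l b_def B_def by simp
  have "b ^ ?q = b ^ (?q - 1) * b"
    by (metis power_minus_mult zero_less_card_finite)
  then have binv: "inverse b ^ (?q - 1) = b / b ^ ?q"
    using nz by (simp add: field_simps)
  have "Li_trunc [pnat_of_nat (?q - 1)] (Suc (Suc d)) = b / (l * a ^ ?q) + inverse b ^ (?q - 1)"
    using Suc by (simp add: Li_trunc_Cons nat_of_pnat_CARD_minus_1 a_def b_def l_def del: One_nat_def)
  \<comment> \<open>Over the denominator \<open>l * b ^ ?q\<close> the first fraction has numerator
    \<open>- b * B ^ ?q\<close>, by \<open>bq\<close>.\<close>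
  also have "\<dots> = b * (l - B ^ ?q) / (l * b ^ ?q)"
    unfolding binv bq using nz by (simp add: field_simps)
  finally show ?case unfolding c l_def b_def .
qed

lemma ell_power_CARD:
  "inverse (A_to_Kinf (ell d :: 'a::{field,finite} poly)) ^ CARD('a) =
     A_to_Kinf (ell 1) * inverse (A_to_Kinf (ell (Suc d))) * Li_trunc [pnat_of_nat (CARD('a) - 1)] (Suc d)"
  unfolding Li_trunc_CARD_minus_1
  using ell_nonzero[of d, where 'a='a] ell_nonzero[of 1, where 'a='a] ell_nonzero[of "Suc d", where 'a='a]
  by (simp add: field_simps)

text \<open>
  Multiplying the previous identity by \<open>Li_trunc (b # w) (Suc d)\<close> and splitting off the last term
  of that sum on the left produces the letter \<open>q + b\<close>.
\<close>

lemma Li_trunc_CARD_plus: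
  fixes b :: pnat and w :: word
  defines "v \<equiv> stuffle_word [pnat_of_nat (CARD('a) - 1)] (b # w)"
  shows "Li_trunc ((pnat_of_nat CARD('a) + b) # w) d =
    A_to_Kinf (ell 1) * Zstar_trunc (Suc d) (prepend (pnat_of_nat 1) v)
      - (Li_trunc (pnat_of_nat CARD('a) # b # w) d :: 'a::{field,finite} fls)"
proof -
  let ?U = "\<lambda>e. inverse (A_to_Kinf (ell e)) :: 'a fls" and ?l = "A_to_Kinf (ell 1) :: 'a fls"
  have v: "Zstar_trunc e v = Li_trunc [pnat_of_nat (CARD('a) - 1)] e * Li_trunc (b # w) e" for e
    unfolding v_def by (rule Zstar_trunc_stuffle_word)
  have step: "?U e ^ CARD('a) * Li_trunc (b # w) (Suc e) = ?l * (?U (Suc e) * Zstar_trunc (Suc e) v)" for e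
    unfolding v ell_power_CARD by simp
  have "Li_trunc ((pnat_of_nat CARD('a) + b) # w) d + Li_trunc (pnat_of_nat CARD('a) # b # w) d =
      (\<Sum>e<d. ?U e ^ CARD('a) * Li_trunc (b # w) (Suc e))"
    by (simp add: Li_trunc_Cons[of _ _ d] Li_trunc_Cons[of b w "Suc _"] Li_trunc_Cons[of b w]
        plus_pnat.rep_eq nat_of_pnat_CARD power_add algebra_simps flip: sum.distrib)
  also have "\<dots> = ?l * (\<Sum>e<d. ?U (Suc e) * Zstar_trunc (Suc e) v)"
    unfolding step by (simp add: sum_distrib_left)
  \<comment> \<open>The index shift adds the term \<open>e = 0\<close>, which is 0 because the
    truncation at 0 is an empty sum.\<close>
  also have "(\<Sum>e<d. ?U (Suc e) * Zstar_trunc (Suc e) v) = (\<Sum>e<Suc d. ?U e * Zstar_trunc e v)"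
    by (simp add: sum.lessThan_Suc_shift v Li_trunc_Cons[of _ _ 0] del: sum.lessThan_Suc)
  also have "\<dots> = Zstar_trunc (Suc d) (prepend (pnat_of_nat 1) v)"
    by (simp add: Zstar_trunc_prepend nat_of_pnat_1 del: One_nat_def sum.lessThan_Suc)
  finally show ?thesis by (simp add: eq_diff_eq)
qed

text \<open>The case of a large first letter: in the limit the shift from \<open>d\<close> to
  \<open>Suc d\<close> disappears.\<close>

lemma Li_CARD_plus:
  fixes b :: pnat and w :: word
  defines "v \<equiv> stuffle_word [pnat_of_nat (CARD('a) - 1)] (b # w)"
  shows "Li ((pnat_of_nat CARD('a) + b) # w) =
    Zstar (pm_scale (Fract (ell 1) 1) (prepend (pnat_of_nat 1) v)
      - Poly_Mapping.single (pnat_of_nat CARD('a) # b # w) (1 :: 'a::{field,finite} poly fract))"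
    (is "Li ?w = Zstar (pm_scale ?c ?p - ?s)")
proof -
  have "(\<lambda>d. Zstar_trunc (Suc d) ?p) \<longlonglongrightarrow> Zstar ?p"
    using LIMSEQ_Suc[OF Zstar_trunc_tendsto] .
  then have "(\<lambda>d. A_to_Kinf (ell 1) * Zstar_trunc (Suc d) ?p + (- 1) * Zstar_trunc d ?s)
      \<longlonglongrightarrow> A_to_Kinf (ell 1) * Zstar ?p + (- 1) * Zstar ?s"
    by (intro fls_tendsto_add fls_tendsto_mult tendsto_const Zstar_trunc_tendsto)
  then have "Li_trunc ?w \<longlonglongrightarrow> A_to_Kinf (ell 1) * Zstar ?p - Zstar ?s"
    by (simp add: Li_trunc_CARD_plus[abs_def] v_def)
  moreover have "Zstar (pm_scale ?c ?p - ?s) + Zstar ?s = A_to_Kinf (ell 1) * Zstar ?p"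
    by (simp add: Zstar_scale Kinf_scale_def K_to_Kinf_Fract del: Zstar_single flip: Zstar_add)
  ultimately have "Li_trunc ?w \<longlonglongrightarrow> Zstar (pm_scale ?c ?p - ?s)"
    by (simp add: eq_diff_eq[symmetric])
  then show ?thesis by (rule LIMSEQ_unique[OF Li_trunc_tendsto])
qed

text \<open>Below a preceding letter \<open>c\<close> the shift to \<open>Suc e\<close> leaves a
  trace: its last term carries a factor \<open>1 / \<ell>\<^sub>e\<close>, which merges with
  \<open>c\<close> into \<open>c + 1\<close>. The relation is then exact for every
  \<open>d\<close>.\<close>

lemma Li_trunc_Cons_CARD_plus:
  fixes b c :: pnat and w :: word
  defines "v \<equiv> stuffle_word [pnat_of_nat (CARD('a) - 1)] (b # w)"
  shows "Li_trunc (c # (pnat_of_nat CARD('a) + b) # w) d =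
    Zstar_trunc d (pm_scale (Fract (ell 1) 1)
        (prepend c (prepend (pnat_of_nat 1) v) + prepend (c + pnat_of_nat 1) v)
      - Poly_Mapping.single (c # pnat_of_nat CARD('a) # b # w) (1 :: 'a::{field,finite} poly fract))"
proof -
  let ?U = "\<lambda>e. inverse (A_to_Kinf (ell e)) :: 'a fls" and ?l = "A_to_Kinf (ell 1) :: 'a fls"
  have "Zstar_trunc (Suc e) (prepend (pnat_of_nat 1) v) =
      Zstar_trunc e (prepend (pnat_of_nat 1) v) + ?U e * Zstar_trunc e v" for e
    by (simp add: Zstar_trunc_prepend nat_of_pnat_1 del: One_nat_def)
  then have "Li_trunc (c # (pnat_of_nat CARD('a) + b) # w) d =
      (\<Sum>e<d. ?U e ^ nat_of_pnat c * (?l * (Zstar_trunc e (prepend (pnat_of_nat 1) v) + ?U e * Zstar_trunc e v)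
        - Li_trunc (pnat_of_nat CARD('a) # b # w) e))"
    unfolding Li_trunc_Cons[of c] Li_trunc_CARD_plus v_def by simp
  also have "\<dots> = ?l * (Zstar_trunc d (prepend c (prepend (pnat_of_nat 1) v))
        + Zstar_trunc d (prepend (c + pnat_of_nat 1) v))
      - Li_trunc (c # pnat_of_nat CARD('a) # b # w) d"
    unfolding Zstar_trunc_prepend[of d] Li_trunc_Cons[of c]
    by (simp add: plus_pnat.rep_eq nat_of_pnat_1 power_add sum_distrib_left sum_subtractf sum.distrib
        algebra_simps del: One_nat_def)
  also have "\<dots> = Zstar_trunc d (pm_scale (Fract (ell 1) 1)
        (prepend c (prepend (pnat_of_nat 1) v) + prepend (c + pnat_of_nat 1) v)
      - Poly_Mapping.single (c # pnat_of_nat CARD('a) # b # w) (1 :: 'a poly fract))"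
    by (simp add: Zstar_trunc_diff Zstar_trunc_scale Zstar_trunc_add Kinf_scale_def K_to_Kinf_Fract)
  finally show ?thesis .
qed

text \<open>A prefix only uses truncated values, so relations valid for every \<open>d\<close> may
  be applied behind it.\<close>

lemma Zstar_trunc_foldr_prepend_cong:
  assumes "\<And>d. Zstar_trunc d u = Zstar_trunc d v"
  shows "Zstar_trunc d (foldr prepend p u) = Zstar_trunc d (foldr prepend p v)"
  using assms by (induction p arbitrary: d) (simp_all add: Zstar_trunc_prepend)

lemma foldr_prepend_single:
  "foldr prepend p (Poly_Mapping.single w 1) = Poly_Mapping.single (p @ w) 1"
  by (induction p) (simp_all add: prepend_single)

lemma Li_append_Cons_CARD_plus:
  fixes b c :: pnat and w p :: word
  defines "v \<equiv> stuffle_word [pnat_of_nat (CARD('a) - 1)] (b # w)"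
  shows "Li (p @ c # (pnat_of_nat CARD('a) + b) # w) =
    Zstar (foldr prepend p (pm_scale (Fract (ell 1) 1)
        (prepend c (prepend (pnat_of_nat 1) v) + prepend (c + pnat_of_nat 1) v)
      - Poly_Mapping.single (c # pnat_of_nat CARD('a) # b # w) (1 :: 'a::{field,finite} poly fract)))"
    (is "Li ?w = Zstar ?u")
proof -
  have "Li_trunc ?w d = Zstar_trunc d ?u" for d
    unfolding Zstar_trunc_single[symmetric] foldr_prepend_single[symmetric]
    by (rule Zstar_trunc_foldr_prepend_cong)
      (simp only: Zstar_trunc_single Li_trunc_Cons_CARD_plus v_def)
  then have "Li_trunc ?w \<longlonglongrightarrow> Zstar ?u"
    using Zstar_trunc_tendsto[of ?u] by presburger
  then show ?thesis by (rule LIMSEQ_unique[OF Li_trunc_tendsto])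
qed

section \<open>Weight and an order on words\<close>

definition weight :: "word \<Rightarrow> nat" where
  "weight w = (\<Sum>a\<leftarrow>w. nat_of_pnat a)"

lemma weight_simps [simp]:
  "weight [] = 0" "weight (a # w) = nat_of_pnat a + weight w" "weight (u @ w) = weight u + weight w"
  by (simp_all add: weight_def)

lemma length_le_weight: "length w \<le> weight w"
proof (induction w)
  case (Cons a w)
  then show ?case using nat_of_pnat_pos[of a] by simp
qed simp

lemma nat_of_pnat_le_weight: "a \<in> set w \<Longrightarrow> nat_of_pnat a \<le> weight w"
  by (induction w) auto

lemma finite_weight_eq: "finite {w. weight w = n}"
proof (rule finite_subset)
  show "{w. weight w = n} \<subseteq> {w. set w \<subseteq> {a. nat_of_pnat a \<le> n} \<and> length w \<le> n}"
    using length_le_weight nat_of_pnat_le_weight by blast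
  have "finite (nat_of_pnat -` {..n})"
    by (rule finite_vimageI) (simp_all add: inj_def nat_of_pnat_inject)
  then show "finite {w. set w \<subseteq> {a. nat_of_pnat a \<le> n} \<and> length w \<le> n}"
    by (intro finite_lists_length_le) (simp add: vimage_def)
qed

text \<open>Length first, then lexicographic order: rewriting a large letter always moves
  upwards.\<close>

definition word_less :: "(word \<times> word) set" where
  "word_less = inv_image (lenlex less_than) (map nat_of_pnat)"

lemma word_less_length: "length u < length w \<Longrightarrow> (u, w) \<in> word_less"
  by (simp add: word_less_def lenlex_conv)

lemma word_less_Cons:
  "nat_of_pnat a < nat_of_pnat b \<Longrightarrow> length u \<le> length w \<Longrightarrow> (a # u, b # w) \<in> word_less"
  by (auto simp: word_less_def Cons_lenlex_iff)

lemma word_less_append: "(u, w) \<in> word_less \<Longrightarrow> (p @ u, p @ w) \<in> word_less"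
  by (induction p) (auto simp: word_less_def Cons_lenlex_iff)

text \<open>Words of one weight form a finite set, on which the acyclic order has a well-founded
  converse.\<close>

lemma word_greater_induct:
  assumes "\<And>w. (\<And>z. weight z = weight w \<Longrightarrow> (w, z) \<in> word_less \<Longrightarrow> P z) \<Longrightarrow> P w"
  shows "P w"
proof -
  let ?S = "{z. weight z = weight w}"
  let ?r = "word_less \<inter> ?S \<times> ?S"
  have "acyclic ?r"
    by (rule acyclic_subset[OF wf_acyclic, of word_less]) (auto simp: word_less_def)
  moreover have "finite ?r"
    by (intro finite_Int disjI2 finite_cartesian_product finite_weight_eq)
  ultimately have wf: "wf (?r\<inverse>)" by (intro finite_acyclic_wf_converse)
  have "weight z = weight w \<longrightarrow> P z" for z
    using wf
  proof (induction z rule: wf_induct_rule)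
    case (less z)
    show ?case
    proof
      assume "weight z = weight w"
      then show "P z" using less by (intro assms[of z]) simp
    qed
  qed
  then show ?thesis by simp
qed

lemma keys_prepend: "Poly_Mapping.keys (prepend a u) \<subseteq> (#) a ` Poly_Mapping.keys u"
proof -
  have "Poly_Mapping.keys (prepend a u) \<subseteq>
      (\<Union>w\<in>Poly_Mapping.keys u. Poly_Mapping.keys (pm_scale (Poly_Mapping.lookup u w) (Poly_Mapping.single (a # w) 1)))"
    unfolding prepend_def lin_ext_def by (rule keys_sum)
  also have "\<dots> \<subseteq> (\<Union>w\<in>Poly_Mapping.keys u. {a # w})"
    by (intro UN_mono) (auto simp: in_keys_iff lookup_single when_def split: if_splits)
  finally show ?thesis by auto
qed

lemma keys_foldr_prepend:
  "Poly_Mapping.keys (foldr prepend p u) \<subseteq> (@) p ` Poly_Mapping.keys u"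
proof (induction p)
  case (Cons a p)
  have "Poly_Mapping.keys (foldr prepend (a # p) u) \<subseteq> (#) a ` Poly_Mapping.keys (foldr prepend p u)"
    by (simp add: keys_prepend)
  also have "\<dots> \<subseteq> (#) a ` (@) p ` Poly_Mapping.keys u"
    using Cons by (rule image_mono)
  finally show ?case by (simp add: image_image)
qed simp

text \<open>Merging two letters adds them, so the weight is kept. The length bounds later ensure
  that rewritten words move upwards in \<open>word_less\<close>.\<close>

lemma keys_stuffle_word:
  assumes "z \<in> Poly_Mapping.keys (stuffle_word u v :: word \<Rightarrow>\<^sub>0 'k::field)"
  shows "weight z = weight u + weight v \<and> length u \<le> length z \<and> length v \<le> length z"
  using assms
proof (induction u v arbitrary: z rule: stuffle_word.induct)
  case (3 a u b v)
  let ?k = "\<lambda>x y. Poly_Mapping.keys (stuffle_word x y :: word \<Rightarrow>\<^sub>0 'k)"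
  have "z \<in> (#) a ` ?k u (b # v) \<union> (#) b ` ?k (a # u) v \<union> (#) (a + b) ` ?k u v"
    using "3.prems" keys_prepend unfolding stuffle_word.simps
    by (blast dest: Poly_Mapping.keys_add[THEN subsetD])
  then show ?case
    using "3.IH" by (fastforce simp: plus_pnat.rep_eq)
qed (simp_all split: if_splits)

section \<open>Reduction to letters at most \<open>q\<close>\<close>

lemma Zstar_in_span:
  assumes "\<And>w. w \<in> Poly_Mapping.keys u \<Longrightarrow> Li w \<in> Kinf_span S"
  shows "Zstar u \<in> Kinf_span S"
  unfolding Zstar_def lin_ext_def using assms by (intro Kinf.span_sum Kinf.span_scale)

text \<open>Upward induction at fixed weight: any letter above \<open>q\<close> is rewritten by
  \<open>Li_CARD_plus\<close> if it comes first and by \<open>Li_append_Cons_CARD_plus\<close>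
  otherwise.\<close>

lemma Li_in_span_bounded:
  "Li w \<in> Kinf_span (Li ` {w. \<forall>a\<in>set w. nat_of_pnat a \<le> CARD('a)} :: 'a::{field,finite} fls set)"
proof (induction w rule: word_greater_induct)
  case (1 w)
  let ?q = "pnat_of_nat CARD('a)" and ?r = "pnat_of_nat (CARD('a) - 1)"
  let ?S = "Li ` {w. \<forall>a\<in>set w. nat_of_pnat a \<le> CARD('a)} :: 'a fls set"
  show ?case
  proof (cases "\<forall>a\<in>set w. nat_of_pnat a \<le> CARD('a)")
    case True
    then show ?thesis by (intro Kinf.span_base) auto
  next
    case False
    then obtain a p t where w: "w = p @ a # t" and a: "nat_of_pnat a > CARD('a)"
      by (metis split_list not_le)
    \<comment> \<open>Positive because \<open>a\<close> exceeds \<open>q\<close>, hence a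
      letter.\<close>
    define b where "b = pnat_of_nat (nat_of_pnat a - CARD('a))"
    have "a = ?q + b"
      using a by (simp add: b_def plus_pnat.rep_eq nat_of_pnat_CARD pnat_of_nat_inverse
          flip: nat_of_pnat_inject)
    then have w: "w = p @ (?q + b) # t" using w by simp
    define v where "v = (stuffle_word [?r] (b # t) :: word \<Rightarrow>\<^sub>0 'a poly fract)"
    have v: "weight z = CARD('a) - 1 + nat_of_pnat b + weight t \<and> Suc (length t) \<le> length z"
      if "z \<in> Poly_Mapping.keys v" for z
      using keys_stuffle_word[OF that[unfolded v_def]]
      by (simp add: nat_of_pnat_CARD_minus_1 del: One_nat_def)
    have sc: "Poly_Mapping.keys (pm_scale c u) \<subseteq> Poly_Mapping.keys u"
      for c and u :: "word \<Rightarrow>\<^sub>0 'a poly fract"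
      by (auto simp: in_keys_iff)
    have pnat: "nat_of_pnat (x + y) = nat_of_pnat x + nat_of_pnat y" for x y
      by (rule plus_pnat.rep_eq)
    have q: "CARD('a) \<ge> 2" by (rule CARD_field_ge_2)
    have "\<exists>u. Li w = (Zstar u :: 'a fls) \<and>
        (\<forall>z\<in>Poly_Mapping.keys u. weight z = weight w \<and> (w, z) \<in> word_less)"
    proof (cases p rule: rev_cases)
      case Nil
      define u where "u = pm_scale (Fract (ell 1) 1) (prepend (pnat_of_nat 1) v)
        - Poly_Mapping.single (?q # b # t) (1 :: 'a poly fract)"
      have "weight z = weight w \<and> (w, z) \<in> word_less" if "z \<in> Poly_Mapping.keys u" for z
      proof -
        have "z \<in> (#) (pnat_of_nat 1) ` Poly_Mapping.keys v \<or> z = ?q # b # t"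
          using that keys_prepend sc unfolding u_def
          by (fastforce dest!: keys_diff[THEN subsetD] simp del: One_nat_def)
        \<comment> \<open>Words from \<open>v\<close> have at least \<open>Suc (length t)\<close>
          letters, so the prefix 1 makes them longer than \<open>w\<close>.\<close>
        then show ?thesis
          using q by (auto simp: w Nil pnat nat_of_pnat_CARD nat_of_pnat_1 simp del: One_nat_def
              intro!: word_less_length dest!: v)
      qed
      moreover have "Li w = Zstar u"
        unfolding w Nil u_def v_def append_Nil by (rule Li_CARD_plus)
      ultimately show ?thesis by blast
    next
      case (snoc p' c)
      define u' where "u' = pm_scale (Fract (ell 1) 1)
          (prepend c (prepend (pnat_of_nat 1) v) + prepend (c + pnat_of_nat 1) v)
        - Poly_Mapping.single (c # ?q # b # t) (1 :: 'a poly fract)"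
      define w' where "w' = c # (?q + b) # t"
      have u': "weight z = weight w' \<and> (w', z) \<in> word_less" if "z \<in> Poly_Mapping.keys u'" for z
      proof -
        have "z \<in> Poly_Mapping.keys (prepend c (prepend (pnat_of_nat 1) v)) \<or>
            z \<in> Poly_Mapping.keys (prepend (c + pnat_of_nat 1) v) \<or> z = c # ?q # b # t"
          using that sc unfolding u'_def
          by (fastforce dest!: keys_diff[THEN subsetD] Poly_Mapping.keys_add[THEN subsetD] simp del: One_nat_def)
        then consider y where "y \<in> Poly_Mapping.keys v" "z = c # pnat_of_nat 1 # y"
          | y where "y \<in> Poly_Mapping.keys v" "z = (c + pnat_of_nat 1) # y"
          | "z = c # ?q # b # t"
          using keys_prepend by blast
        then show ?thesis
        proof cases
          case 1
          then show ?thesis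
            using v[of y] q by (auto simp: w'_def pnat nat_of_pnat_CARD nat_of_pnat_1 simp del: One_nat_def
              intro!: word_less_length)
        next
          \<comment> \<open>The only words whose length may equal that of \<open>w'\<close>; their
            first letter \<open>c + 1\<close> is larger.\<close>
          case 2
          then show ?thesis
            using v[of y] q by (auto simp: w'_def pnat nat_of_pnat_CARD nat_of_pnat_1 simp del: One_nat_def
              intro!: word_less_Cons)
        next
          case 3
          then show ?thesis
            by (auto simp: w'_def pnat nat_of_pnat_CARD intro!: word_less_length)
        qed
      qed
      have w: "w = p' @ w'" by (simp add: w snoc w'_def)
      have "weight z = weight w \<and> (w, z) \<in> word_less" if "z \<in> Poly_Mapping.keys (foldr prepend p' u')" for z
        using that keys_foldr_prepend[of p' u'] u' word_less_append unfolding w by fastforce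
      moreover have "Li w = Zstar (foldr prepend p' u')"
        unfolding w w'_def u'_def v_def by (rule Li_append_Cons_CARD_plus)
      ultimately show ?thesis by blast
    qed
    then obtain u where "Li w = (Zstar u :: 'a fls)"
      "\<forall>z\<in>Poly_Mapping.keys u. weight z = weight w \<and> (w, z) \<in> word_less" by blast
    then show ?thesis using 1 by (auto intro: Zstar_in_span)
  qed
qed

lemma Li_in_MZV_space: "Li w \<in> (MZV_space :: 'a::{field,finite} fls set)"
proof -
  have "Li ` {w. \<forall>a\<in>set w. nat_of_pnat a \<le> CARD('a)} \<subseteq> (range zeta_A :: 'a fls set)"
    using zeta_A_eq_Li[where 'a='a] by (metis (mono_tags, lifting) image_subsetI mem_Collect_eq rangeI)
  then show ?thesis
    unfolding MZV_space_def using Kinf.span_mono Li_in_span_bounded by blast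
qed

theorem theoremE:
  shows "(\<forall>w. Li w \<in> (MZV_space :: 'a::{field,finite} fls set)) \<and>
    range Zstar \<subseteq> (MZV_space :: 'a fls set) \<and>
    (\<forall>w. Zstar (Poly_Mapping.single w 1) = (Li w :: 'a fls)) \<and>
    Vector_Spaces.linear pm_scale Kinf_scale
      (Zstar :: (word \<Rightarrow>\<^sub>0 'a poly fract) \<Rightarrow> 'a fls) \<and>
    Zstar (Poly_Mapping.single [] 1) = (1 :: 'a fls) \<and>
    (\<forall>u v :: word \<Rightarrow>\<^sub>0 'a poly fract. Zstar (stuffle_K u v) = Zstar u * Zstar v)"
proof -
  \<comment> \<open>All truncated sums of the empty word are 1, hence so is their limit.\<close>
  have "(\<lambda>_. 1) \<longlonglongrightarrow> (Li [] :: 'a fls)"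
    using Li_trunc_tendsto[of "[]", where 'a='a] unfolding Li_trunc_Nil[abs_def] .
  then have "Li [] = (1 :: 'a fls)"
    by (rule LIMSEQ_unique[OF _ tendsto_const])
  moreover have "range Zstar \<subseteq> (MZV_space :: 'a fls set)"
    using Zstar_in_span[of _ "range zeta_A"] Li_in_MZV_space unfolding MZV_space_def by blast
  ultimately show ?thesis
    using Li_in_MZV_space linear_Zstar by (auto simp: stuffle_K_eq_stuffle Zstar_stuffle)
qed

end
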